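(* The operator $\mathcal{H}:(cabv(T,X,0),\|\cdot\|_{MK}^* )\to(cabv(T,X,0),\|\cdot\|_{MK}^* )$ (the restriction of $\mathcal{H}$ to the subspace $cabv(T,X,0)$, which $\mathcal{H}$ maps into itself) is linear and continuous, and its operator norm with respect to $\|\cdot\|_{MK}^*$ satisfies $$\|\mathcal{H}\|_{o,MK^*}\leq\int_\Theta\|R_\theta\|_o\, r_\theta\,dW(\theta).$$
   Context: $K$ is $\mathbb{R}$ or $\mathbb{C}$. $(\Theta,\Sigma,W)$ is a measure space, $(T,d)$ is a compact metric space with at least two elements, and $X$ is a non-null Hilbert space over $K$ with scalar product $(\cdot,\cdot)$, linear in the first and antilinear in the second variable. For a topological space $Z$, $\mathcal{B}_Z$ denotes its Borel $\sigma$-algebra. $\omega:T\times\Theta\to T$ is $(\mathcal{B}_T\otimes\Sigma,\mathcal{B}_T)$-measurable and $R:X\times\Theta\to X$ is $(\mathcal{B}_X\otimes\Sigma,\mathcal{B}_X)$-measurable. For $\theta\in\Theta$ put $\omega_\theta(t)=\omega(t,\theta)$ and $R_\theta(x)=R(x,\theta)$. For every $\theta\in\Theta$: $R_\theta$ is a continuous linear operator on $X$, with operator norm $\|R_\theta\|_o$; and $\omega_\theta:T\to T$ is Lipschitz with (smallest) Lipschitz constant $r_\theta=\sup_{s\ne t} d(\omega_\theta(s),\omega_\theta(t))/d(s,t)<\infty$. The function $\theta\mapsto\|R_\theta\|_o$ is assumed $\Sigma$-measurable ($\theta\mapsto r_\theta$ is then automatically $\Sigma$-measurable), and it is assumed that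 $\int_\Theta\|R_\theta\|_o(1+r_\theta)\,dW(\theta)<\infty$. $\mathcal{C}(T,X)$ is the Banach space of continuous functions $f:T\to X$ with norm $\|f\|_\infty=\sup_{t\in T}\|f(t)\|$, and $\mathcal{C}(T,X)'$ is its dual. The continuous linear operator $H_C:\mathcal{C}(T,X)\to\mathcal{C}(T,X)$ is given by the Bochner integral $H_C(f)(t)=\int_\Theta (R_\theta\circ f\circ\omega_\theta)(t)\,dW(\theta)$, and its adjoint $H_C':\mathcal{C}(T,X)'\to\mathcal{C}(T,X)'$ by $H_C'(y)=y\circ H_C$. $cabv(T,X)$ is the Banach space of $\sigma$-additive measures $\mu:\mathcal{B}_T\to X$ of finite total variation, with the variational norm $\|\mu\|=|\mu|(T)$. The (sesquilinear uniform) integral is defined as follows: for a simple function $f=\sum_{i=1}^m\varphi_{A_i}x_i$ (where $(A_i)$ is a partition of $T$ into Borel sets, $\varphi_{A_i}$ is the indicator function of $A_i$, $x_i\in X$) and $\mu\in cabv(T,X)$, $\int f\,d\mu=\sum_{i=1}^m(x_i,\mu(A_i))$; for $f$ a uniform limit of simple functions $f_m$ (in particular for every $f\in\mathcal{C}(T,X)$), $\int f\,d\mu=\lim_m\int f_m\,d\mu$. The map $\Phi:cabv(T,X)\to\mathcal{C}(T,X)'$, $\Phi(m)(f)=\int f\,dm$, is an antilinear isometric bijection. The linear operator $\mathcal{H}:cabv(T,X)\to cabv(T,X)$ is defined by $\mathcal{H}=\Phi^{-1}\circ H_C'\circ\Phi$. $cabv(T,X,0)=\{\mu\in cabv(T,X)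 : \mu(T)=0\}$. For a Lipschitz function $f:T\to X$ put $\|f\|_L=\sup_{s\neq t}\|f(s)-f(t)\|/d(s,t)$. The modified Monge-Kantorovich norm on $cabv(T,X,0)$ is $\|\mu\|_{MK}^*=\sup\{|\int f\,d\mu| : f:T\to X \text{ Lipschitz},\ \|f\|_{L}\leq 1\}$. *)

theory Defs
  imports "HOL-Analysis.Analysis"
begin

section \<open>Hilbert spaces over the reals or the complex numbers\<close>

text \<open>
  The scalar field \<open>K\<close> is either \<open>\<real>\<close> or all of the complex numbers, viewed as a subset of
  \<^typ>\<open>complex\<close>; \<open>sc\<close> is the multiplication by scalars from \<open>K\<close> (its values outside \<open>K\<close> are
  irrelevant) and \<open>ip\<close> the \<open>K\<close>-valued scalar product. The class \<^class>\<open>banach\<close> supplies the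
  underlying real vector space, the norm and its completeness.
\<close>

locale hilbert_space_over =
  fixes K :: "complex set"
    and sc :: "complex \<Rightarrow> 'x::banach \<Rightarrow> 'x"
    and ip :: "'x \<Rightarrow> 'x \<Rightarrow> complex"
  assumes K_cases: "K = \<real> \<or> K = UNIV"
    and sc_add_right: "c \<in> K \<Longrightarrow> sc c (x + y) = sc c x + sc c y"
    and sc_add_left: "c \<in> K \<Longrightarrow> d \<in> K \<Longrightarrow> sc (c + d) x = sc c x + sc d x"
    and sc_sc: "c \<in> K \<Longrightarrow> d \<in> K \<Longrightarrow> sc c (sc d x) = sc (c * d) x"
    and sc_of_real: "sc (of_real r) x = r *\<^sub>R x"
    and ip_in_K: "ip x y \<in> K"
    and ip_add_left: "ip (x + y) z = ip x z + ip y z"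
    and ip_sc_left: "c \<in> K \<Longrightarrow> ip (sc c x) y = c * ip x y"
    and ip_commute: "ip y x = cnj (ip x y)"
    and ip_self: "ip x x = of_real ((norm x)\<^sup>2)"

lemma hilbert_space_over_real:
  "hilbert_space_over \<real> (\<lambda>c x. Re c *\<^sub>R x)
     (\<lambda>(x::'x::{banach, real_inner}) y. complex_of_real (x \<bullet> y))"
  by unfold_locales
    (auto simp: algebra_simps inner_simps inner_commute power2_norm_eq_inner elim!: Reals_cases)

lemma hilbert_space_over_complex:
  "hilbert_space_over UNIV (*) (\<lambda>x y. x * cnj y)"
  by unfold_locales
    (auto simp: algebra_simps complex_norm_square scaleR_conv_of_real simp del: of_real_power)

definition cont_linear_over ::
    "complex set \<Rightarrow> (complex \<Rightarrow> 'x \<Rightarrow> 'x) \<Rightarrow> ('x::real_normed_vector \<Rightarrow> 'x) \<Rightarrow> bool" where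
  "cont_linear_over K sc A \<longleftrightarrow> bounded_linear A \<and> (\<forall>c\<in>K. \<forall>x. A (sc c x) = sc c (A x))"


section \<open>The Bochner integral without a separability assumption\<close>

text \<open>
  The Bochner integral of HOL-Analysis is restricted to second countable codomains. The following
  repeats its definition for an arbitrary Banach space, see \<open>has_bochner_iff\<close> below.
\<close>

definition has_bochner :: "'a measure \<Rightarrow> ('a \<Rightarrow> 'x::banach) \<Rightarrow> 'x \<Rightarrow> bool" where
  "has_bochner M f x \<longleftrightarrow> f \<in> borel_measurable M \<and>
     (\<exists>s. (\<forall>i. Bochner_Integration.simple_bochner_integrable M (s i)) \<and>
          (\<lambda>i. \<integral>\<^sup>+ a. ennreal (norm (f a - s i a)) \<partial>M) \<longlonglongrightarrow> 0 \<and>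
          (\<lambda>i. Bochner_Integration.simple_bochner_integral M (s i)) \<longlonglongrightarrow> x)"

definition bochner_integrable :: "'a measure \<Rightarrow> ('a \<Rightarrow> 'x::banach) \<Rightarrow> bool" where
  "bochner_integrable M f \<longleftrightarrow> (\<exists>x. has_bochner M f x)"

definition bochner_integral :: "'a measure \<Rightarrow> ('a \<Rightarrow> 'x::banach) \<Rightarrow> 'x" where
  "bochner_integral M f = (THE x. has_bochner M f x)"

lemma has_bochner_iff:
  fixes f :: "'a \<Rightarrow> 'x::{banach, second_countable_topology}"
  shows "has_bochner M f x \<longleftrightarrow> has_bochner_integral M f x"
  unfolding has_bochner_def has_bochner_integral.simps by blast


section \<open>Vector measures of bounded variation\<close>

definition total_variation ::
    "('t::topological_space set \<Rightarrow> 'x::real_normed_vector) \<Rightarrow> 't set \<Rightarrow> ennreal" where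
  "total_variation \<mu> A =
     (SUP P \<in> {P. finite P \<and> P \<subseteq> sets borel \<and> disjoint P \<and> \<Union>P = A}. \<Sum>B\<in>P. ennreal (norm (\<mu> B)))"

text \<open>
  Measures are total functions on sets; the value \<open>0\<close> outside the Borel sets is prescribed so that
  each measure has a single representative.
\<close>

definition cabv :: "('t::topological_space set \<Rightarrow> 'x::real_normed_vector) set" where
  "cabv = {\<mu>. (\<forall>A. A \<notin> sets borel \<longrightarrow> \<mu> A = 0) \<and>
     (\<forall>A :: nat \<Rightarrow> 't set. range A \<subseteq> sets borel \<longrightarrow> disjoint_family A \<longrightarrow>
        (\<lambda>i. \<mu> (A i)) sums \<mu> (\<Union>i. A i)) \<and>
     total_variation \<mu> UNIV < \<infinity>}"

definition cabv0 :: "('t::topological_space set \<Rightarrow> 'x::real_normed_vector) set" where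
  "cabv0 = {\<mu> \<in> cabv. \<mu> UNIV = 0}"


section \<open>The sesquilinear uniform integral\<close>

text \<open>The sum runs over the canonical partition of the space into the level sets of \<open>f\<close>.\<close>

definition simple_sint ::
    "('x \<Rightarrow> 'x \<Rightarrow> complex) \<Rightarrow> ('t \<Rightarrow> 'x) \<Rightarrow> ('t set \<Rightarrow> 'x) \<Rightarrow> complex" where
  "simple_sint ip f \<mu> = (\<Sum>x\<in>range f. ip x (\<mu> (f -` {x})))"

definition has_sint ::
    "('x \<Rightarrow> 'x \<Rightarrow> complex) \<Rightarrow> ('t::topological_space \<Rightarrow> 'x::real_normed_vector) \<Rightarrow>
       ('t set \<Rightarrow> 'x) \<Rightarrow> complex \<Rightarrow> bool" where
  "has_sint ip f \<mu> l \<longleftrightarrow>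
     (\<exists>s. (\<forall>m::nat. simple_function borel (s m)) \<and> uniform_limit UNIV s f sequentially \<and>
          (\<lambda>m. simple_sint ip (s m) \<mu>) \<longlonglongrightarrow> l)"

definition sint ::
    "('x \<Rightarrow> 'x \<Rightarrow> complex) \<Rightarrow> ('t::topological_space \<Rightarrow> 'x::real_normed_vector) \<Rightarrow>
       ('t set \<Rightarrow> 'x) \<Rightarrow> complex" where
  "sint ip f \<mu> = (THE l. has_sint ip f \<mu> l)"


section \<open>The operators on continuous functions and on measures\<close>

text \<open>
  For a compact space \<open>'t\<close>, the type of bounded continuous functions with its supremum norm is the
  Banach space of all continuous functions.
\<close>

definition Phi ::
    "('x \<Rightarrow> 'x \<Rightarrow> complex) \<Rightarrow> ('t::topological_space set \<Rightarrow> 'x::real_normed_vector) \<Rightarrow>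
       ('t \<Rightarrow>\<^sub>C 'x) \<Rightarrow> complex" where
  "Phi ip \<mu> = (\<lambda>f. sint ip (apply_bcontfun f) \<mu>)"

definition HC ::
    "'th measure \<Rightarrow> ('x \<Rightarrow> 'th \<Rightarrow> 'x) \<Rightarrow> ('t \<Rightarrow> 'th \<Rightarrow> 't) \<Rightarrow>
       ('t::topological_space \<Rightarrow>\<^sub>C 'x::banach) \<Rightarrow> ('t \<Rightarrow>\<^sub>C 'x)" where
  "HC W R \<omega> f = Bcontfun (\<lambda>t. bochner_integral W (\<lambda>\<theta>. R (apply_bcontfun f (\<omega> t \<theta>)) \<theta>))"

definition HC_adjoint ::
    "'th measure \<Rightarrow> ('x \<Rightarrow> 'th \<Rightarrow> 'x) \<Rightarrow> ('t \<Rightarrow> 'th \<Rightarrow> 't) \<Rightarrow>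
       (('t::topological_space \<Rightarrow>\<^sub>C 'x::banach) \<Rightarrow> complex) \<Rightarrow> ('t \<Rightarrow>\<^sub>C 'x) \<Rightarrow> complex" where
  "HC_adjoint W R \<omega> y = y \<circ> HC W R \<omega>"

definition Hop ::
    "('x \<Rightarrow> 'x \<Rightarrow> complex) \<Rightarrow> 'th measure \<Rightarrow> ('x \<Rightarrow> 'th \<Rightarrow> 'x) \<Rightarrow> ('t \<Rightarrow> 'th \<Rightarrow> 't) \<Rightarrow>
       ('t::topological_space set \<Rightarrow> 'x::banach) \<Rightarrow> ('t set \<Rightarrow> 'x)" where
  "Hop ip W R \<omega> = inv_into cabv (Phi ip) \<circ> HC_adjoint W R \<omega> \<circ> Phi ip"


section \<open>The modified Monge-Kantorovich norm\<close>

definition lip_const :: "('a::metric_space \<Rightarrow> 'b::metric_space) \<Rightarrow> real" where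
  "lip_const f = (SUP (s, t) \<in> {(s, t). s \<noteq> t}. dist (f s) (f t) / dist s t)"

text \<open>
  As a supremum of reals, \<open>lip_const\<close> is meaningful only for Lipschitz functions, whence the first
  condition on \<open>f\<close>. On \<open>cabv0\<close> over a compact space the supremum in \<open>mk_norm\<close> is finite.
\<close>

definition mk_norm ::
    "('x \<Rightarrow> 'x \<Rightarrow> complex) \<Rightarrow> ('t::metric_space set \<Rightarrow> 'x::real_normed_vector) \<Rightarrow> real" where
  "mk_norm ip \<mu> =
     (SUP f \<in> {f. (\<exists>C. C-lipschitz_on UNIV f) \<and> lip_const f \<le> 1}. cmod (sint ip f \<mu>))"

text \<open>Extended real valued, so that a bound on it entails finiteness.\<close>

definition mk_op_norm ::
    "('x \<Rightarrow> 'x \<Rightarrow> complex) \<Rightarrow>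
       (('t::metric_space set \<Rightarrow> 'x::real_normed_vector) \<Rightarrow> ('t set \<Rightarrow> 'x)) \<Rightarrow> ereal" where
  "mk_op_norm ip H = (SUP \<mu> \<in> {\<mu> \<in> cabv0. mk_norm ip \<mu> \<le> 1}. ereal (mk_norm ip (H \<mu>)))"

end

theory Submission
  imports Defs
begin

text \<open>
  Averaging over \<open>\<theta>\<close> maps a continuous function \<open>f\<close> to \<open>HC f\<close>, and since the operator with index \<open>\<theta>\<close>
  multiplies Lipschitz constants by at most \<open>norm R\<^sub>\<theta> * r\<^sub>\<theta>\<close>, the average multiplies them by at most
  the integral \<open>c\<close> of this function (\<open>lipschitz_HCf\<close>). The operator \<open>H\<close> on measures is dual to
  \<open>HC\<close>: integrating \<open>f\<close> against \<open>H \<mu>\<close> amounts to integrating \<open>HC f\<close> against \<open>\<mu>\<close>. As the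
  Monge-Kantorovich norm is a supremum over functions with Lipschitz constant at most one, it grows
  at most by the factor \<open>c\<close> under \<open>H\<close>. This is \<open>mk_norm_transported_le\<close>. Continuity follows by
  linearity.

  The substance of the proof is the duality, that is, that the functional \<open>f \<mapsto> \<integral> HC f d\<mu>\<close> is
  represented by a measure. The general theorem on the dual of the space of continuous functions is
  avoided by writing the measure down. Moving \<open>R\<^sub>\<theta>\<close> and \<open>\<omega>\<^sub>\<theta>\<close> to the other side of the scalar
  product suggests the measure \<open>\<nu>\<close> with \<open>(x, \<nu> A) = \<integral> (R\<^sub>\<theta> x, \<mu> (\<omega>\<^sub>\<theta> -` A)) dW\<close> for all \<open>x\<close>; such
  a vector \<open>\<nu> A\<close> exists by the Riesz theorem for Hilbert spaces (\<open>riesz_representation\<close>). Two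
  points need care.

  \<^item> The integrand must be measurable in \<open>\<theta>\<close>, and the two integrations must be interchanged, for a
    vector measure \<open>\<mu>\<close>. A map \<open>q\<close> of \<open>T\<close> into itself with finitely many values and close to the
    identity yields Riemann sums that converge to the integral of a continuous function; on these
    sums both tasks are trivial, and dominated convergence does the rest (\<open>sint_HCf\<close>,
    \<open>sint_transported\<close>). Indicator functions of closed sets are limits of continuous functions, and
    Dynkin's argument passes from closed sets to Borel sets (\<open>ip_vimage_measurable\<close>).

  \<^item> The measure \<open>\<nu>\<close> must have finite variation and be countably additive. It is dominated by an
    average of image measures of the total variation of \<open>\<mu>\<close>, which is a finite measure
    (\<open>total_variation_sigma_additive\<close>, \<open>norm_transported_le\<close>).

  Finally \<open>\<nu>\<close> is the only measure with these integrals (\<open>inj_on_Phi\<close>), so \<open>H \<mu> = \<nu>\<close>. The weak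
  formula for \<open>\<nu>\<close> also shows that \<open>H\<close> is linear and preserves the condition \<open>\<mu> T = 0\<close>.
\<close>

section \<open>The scalar product\<close>

context hilbert_space_over
begin

lemma ip_zero_left [simp]: "ip 0 y = 0"
  using ip_add_left[of 0 0 y] by simp

lemma of_real_in_K: "of_real r \<in> K"
  using K_cases by auto

lemma ip_scaleR_left: "ip (r *\<^sub>R x) y = r *\<^sub>R ip x y"
  using ip_sc_left[OF of_real_in_K, of r x y] by (simp add: sc_of_real scaleR_conv_of_real)

lemma ip_add_right: "ip x (y + z) = ip x y + ip x z"
  by (metis ip_add_left ip_commute complex_cnj_add)

lemma ip_scaleR_right: "ip x (r *\<^sub>R y) = r *\<^sub>R ip x y"
  by (metis ip_scaleR_left ip_commute complex_cnj_scaleR)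

lemma ip_sc_right: "c \<in> K \<Longrightarrow> ip x (sc c y) = cnj c * ip x y"
  by (metis ip_sc_left ip_commute complex_cnj_mult)

lemma norm_sc:
  assumes "c \<in> K" shows "norm (sc c x) = cmod c * norm x"
proof -
  have "of_real ((norm (sc c x))\<^sup>2) = c * cnj c * of_real ((norm x)\<^sup>2)"
    using assms by (simp add: ip_self[symmetric] ip_sc_left ip_sc_right del: of_real_power)
  also have "\<dots> = of_real ((cmod c * norm x)\<^sup>2)"
    by (simp add: complex_norm_square[symmetric] power_mult_distrib)
  finally have "(norm (sc c x))\<^sup>2 = (cmod c * norm x)\<^sup>2"
    using of_real_eq_iff by blast
  then show ?thesis by simp
qed

lemma norm_add_sq: "(norm (x + y))\<^sup>2 = (norm x)\<^sup>2 + 2 * Re (ip x y) + (norm y)\<^sup>2"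
proof -
  have "Re (ip (x + y) (x + y)) = Re (ip x x) + Re (ip x y) + Re (ip y x) + Re (ip y y)"
    by (simp add: ip_add_left ip_add_right)
  then show ?thesis
    by (simp add: ip_self ip_commute[of y x] del: of_real_power)
qed

lemma Re_ip_le: "Re (ip x y) \<le> norm x * norm y"
proof -
  have "(norm (x + y))\<^sup>2 \<le> (norm x + norm y)\<^sup>2"
    by (intro power_mono norm_triangle_ineq) simp
  then show ?thesis
    by (simp add: norm_add_sq power2_sum)
qed

text \<open>Rotating \<open>x\<close> by the phase of \<open>ip x y\<close> reduces the modulus to the real part.\<close>

lemma cmod_ip_le: "cmod (ip x y) \<le> norm x * norm y"
proof (cases "ip x y = 0")
  case False
  define c where "c = cnj (ip x y) / of_real (cmod (ip x y))"
  have c: "c \<in> K"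
  proof (cases "K = UNIV")
    case False
    then have "ip x y \<in> \<real>" using K_cases ip_in_K[of x y] by auto
    then show ?thesis using K_cases False
      unfolding c_def by (metis Reals_cnj_iff Reals_divide Reals_of_real)
  qed simp
  have "c * ip x y = of_real (cmod (ip x y))"
    using False unfolding c_def
    by (simp add: mult.commute[of "cnj _"] complex_norm_square[symmetric] power2_eq_square)
  then have "cmod (ip x y) = Re (ip (sc c x) y)"
    using c by (simp add: ip_sc_left)
  also have "\<dots> \<le> norm (sc c x) * norm y" by (rule Re_ip_le)
  also have "\<dots> = norm x * norm y"
    using False unfolding norm_sc[OF c] by (simp add: c_def norm_divide)
  finally show ?thesis .
qed simp

sublocale ip: bounded_bilinear ip
  by standard
    (auto simp: ip_add_left ip_add_right ip_scaleR_left ip_scaleR_right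
      intro!: exI[of _ 1] cmod_ip_le)

lemma ip_ext: "(\<And>x. ip x y = ip x z) \<Longrightarrow> y = z"
proof -
  assume "\<And>x. ip x y = ip x z"
  then have "ip (y - z) (y - z) = 0" by (simp add: ip.diff_right)
  then show "y = z" by (simp add: ip_self)
qed

text \<open>
  The Riesz representation theorem. A minimising sequence of \<open>(norm x)\<^sup>2 - 2 * Re (\<phi> x)\<close> is
  a Cauchy sequence by the parallelogram law, and the derivative of this function vanishes at the
  limit. This settles the real parts; over the complex numbers, rotating by \<open>\<i>\<close> yields the imaginary
  parts.
\<close>

lemma riesz_representation:
  assumes add: "\<And>x y. \<phi> (x + y) = \<phi> x + \<phi> y"
    and sc: "\<And>c x. c \<in> K \<Longrightarrow> \<phi> (sc c x) = c * \<phi> x"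
    and inK: "\<And>x. \<phi> x \<in> K"
    and bound: "\<And>x. cmod (\<phi> x) \<le> C * norm x"
  shows "\<exists>y. \<forall>x. ip x y = \<phi> x"
proof -
  have scaleR: "\<phi> (r *\<^sub>R x) = r *\<^sub>R \<phi> x" for r x
    using sc[OF of_real_in_K, of r x] by (simp add: sc_of_real scaleR_conv_of_real)
  define J where "J x = (norm x)\<^sup>2 - 2 * Re (\<phi> x)" for x
  have J_ge: "- (C\<^sup>2) \<le> J x" for x
  proof -
    have "Re (\<phi> x) \<le> C * norm x" using bound[of x] complex_Re_le_cmod[of "\<phi> x"] by linarith
    moreover have "0 \<le> (norm x - C)\<^sup>2" by simp
    ultimately show ?thesis unfolding J_def power2_diff by (simp add: algebra_simps)
  qed
  define m where "m = (INF x. J x)"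
  have bdd: "bdd_below (range J)" using J_ge by (auto intro!: bdd_belowI)
  have m_le: "m \<le> J x" for x unfolding m_def by (rule cINF_lower[OF bdd]) simp
  have "\<exists>x. J x < m + inverse (real (Suc n))" for n
  proof -
    have "m < m + inverse (real (Suc n))" by simp
    then show ?thesis unfolding m_def using cINF_less_iff[OF _ bdd] by blast
  qed
  then obtain u where u: "J (u n) < m + inverse (real (Suc n))" for n by metis
  have para: "(norm (x - y))\<^sup>2 \<le> 2 * (J x - m) + 2 * (J y - m)" for x y
  proof -
    define z where "z = (1/2) *\<^sub>R (x + y)"
    have "norm z = norm (x + y) / 2" unfolding z_def by (simp del: scaleR_add_right)
    then have "4 * (norm z)\<^sup>2 = (norm (x + y))\<^sup>2" by (simp only: power_divide) simp
    moreover have "Re (\<phi> z) = (Re (\<phi> x) + Re (\<phi> y)) / 2" unfolding z_def scaleR add by simp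
    ultimately have "4 * J z = (norm (x + y))\<^sup>2 - 4 * (Re (\<phi> x) + Re (\<phi> y))"
      unfolding J_def by (simp add: algebra_simps)
    moreover have "(norm (x - y))\<^sup>2 = (norm x)\<^sup>2 - 2 * Re (ip x y) + (norm y)\<^sup>2"
      using norm_add_sq[of x "- y"] by (simp add: ip.minus_right)
    ultimately have "(norm (x - y))\<^sup>2 = 2 * J x + 2 * J y - 4 * J z"
      using norm_add_sq[of x y] unfolding J_def by simp
    then show ?thesis using m_le[of z] by simp
  qed
  have "Cauchy u"
  proof (rule metric_CauchyI)
    fix e :: real assume e: "0 < e"
    obtain N where N: "inverse (real (Suc N)) < e\<^sup>2 / 4"
      using reals_Archimedean[of "e\<^sup>2 / 4"] e by auto
    have "dist (u i) (u j) < e" if "N \<le> i" "N \<le> j" for i j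
    proof -
      have small: "J (u k) - m < e\<^sup>2 / 4" if "N \<le> k" for k
      proof -
        have "inverse (real (Suc k)) \<le> inverse (real (Suc N))"
          using that by (simp add: le_imp_inverse_le)
        then show ?thesis using u[of k] N by linarith
      qed
      have "(norm (u i - u j))\<^sup>2 < e\<^sup>2"
        using para[of "u i" "u j"] small[OF that(1)] small[OF that(2)] by simp
      then show ?thesis using e by (simp add: dist_norm power_less_imp_less_base)
    qed
    then show "\<exists>M. \<forall>i\<ge>M. \<forall>j\<ge>M. dist (u i) (u j) < e" by blast
  qed
  then obtain y where y: "u \<longlonglongrightarrow> y" using Cauchy_convergent convergent_def by blast
  have "bounded_linear \<phi>"
    by (rule bounded_linear_intro[where K=C]) (auto simp: add scaleR bound mult.commute)
  then have "(\<lambda>n. J (u n)) \<longlonglongrightarrow> J y"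
    unfolding J_def by (intro tendsto_intros y bounded_linear.tendsto[of \<phi>])
  moreover have "(\<lambda>n. J (u n)) \<longlonglongrightarrow> m"
  proof (rule tendsto_sandwich[of "\<lambda>_. m" _ _ "\<lambda>n. m + inverse (real (Suc n))"])
    show "(\<lambda>n. m + inverse (real (Suc n))) \<longlonglongrightarrow> m"
      using tendsto_add[OF tendsto_const LIMSEQ_inverse_real_of_nat, of m] by simp
    show "\<forall>\<^sub>F n in sequentially. J (u n) \<le> m + inverse (real (Suc n))"
      using u by (auto intro!: always_eventually less_imp_le)
  qed (use m_le in auto)
  ultimately have Jy: "J y = m" by (rule LIMSEQ_unique)
  have Re_eq: "Re (ip x y) = Re (\<phi> x)" for x
  proof -
    let ?a = "Re (ip x y) - Re (\<phi> x)"
    have quad: "0 \<le> 2 * r * ?a + r\<^sup>2 * (norm x)\<^sup>2" for r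
    proof -
      have "J y \<le> J (y + r *\<^sub>R x)" using m_le Jy by simp
      moreover have "Re (ip y x) = Re (ip x y)" using ip_commute[of y x] by simp
      ultimately show ?thesis
        by (simp add: J_def norm_add_sq add scaleR ip_scaleR_right power_mult_distrib algebra_simps)
    qed
    show ?thesis
    proof (cases "x = 0")
      case True
      then show ?thesis using scaleR[of 0 0] by simp
    next
      case False
      \<comment> \<open>the minimum of the quadratic polynomial in \<open>r\<close>\<close>
      define r where "r = - ?a / (norm x)\<^sup>2"
      have "2 * r * ?a + r\<^sup>2 * (norm x)\<^sup>2 = - (?a\<^sup>2 / (norm x)\<^sup>2)"
        using False unfolding r_def by (simp add: field_simps power2_eq_square)
      then have "?a\<^sup>2 / (norm x)\<^sup>2 \<le> 0" using quad[of r] by linarith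
      then have "?a\<^sup>2 \<le> 0" using False by (simp add: divide_le_0_iff)
      then show ?thesis by simp
    qed
  qed
  have "ip x y = \<phi> x" for x
  proof (cases "K = UNIV")
    case True
    have "Re (ip (sc \<i> x) y) = Re (\<phi> (sc \<i> x))" by (rule Re_eq)
    then have "Im (ip x y) = Im (\<phi> x)" using True by (simp add: ip_sc_left sc)
    then show ?thesis using Re_eq[of x] by (simp add: complex_eq_iff)
  next
    case False
    then have "ip x y \<in> \<real>" "\<phi> x \<in> \<real>" using K_cases ip_in_K inK by auto
    then show ?thesis using Re_eq[of x] by (simp add: complex_eq_iff complex_is_Real_iff)
  qed
  then show ?thesis by blast
qed

text \<open>
  The scalar product with a fixed vector is a bounded linear functional, so it maps approximating
  simple functions to approximating simple functions. As scalar products separate points, this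
  reduces vector valued integrals to scalar ones.
\<close>

lemma has_bochner_ip:
  assumes "has_bochner M f z"
  shows "has_bochner_integral M (\<lambda>a. ip (f a) y) (ip z y)"
proof -
  obtain s where f: "f \<in> borel_measurable M"
    and s: "\<And>i. Bochner_Integration.simple_bochner_integrable M (s i)"
    and lim: "(\<lambda>i. \<integral>\<^sup>+ a. ennreal (norm (f a - s i a)) \<partial>M) \<longlonglongrightarrow> 0"
    and int: "(\<lambda>i. Bochner_Integration.simple_bochner_integral M (s i)) \<longlonglongrightarrow> z"
    using assms unfolding has_bochner_def by blast
  let ?L = "\<lambda>z. ip z y"
  have L: "bounded_linear ?L" by (rule ip.bounded_linear_left)
  interpret L: bounded_linear ?L by (rule L)
  have meas: "(\<lambda>a. ?L (f a)) \<in> borel_measurable M"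
    by (rule borel_measurable_continuous_on[OF L.continuous_on[OF continuous_on_id] f])
  have norm_meas: "(\<lambda>a. norm (f a - s i a)) \<in> borel_measurable M" for i
  proof (rule measurable_compose_countable'[where f = "\<lambda>v a. norm (f a - v)" and I = "s i ` space M"])
    have sf: "simple_function M (s i)" using s[of i] by (rule simple_bochner_integrable.cases)
    then show "countable (s i ` space M)" by (intro countable_finite simple_functionD)
    show "s i \<in> measurable M (count_space (s i ` space M))"
      using sf by (simp add: measurable_count_space_eq2 simple_functionD)
    show "(\<lambda>a. norm (f a - v)) \<in> borel_measurable M" for v
      by (rule borel_measurable_continuous_on[OF _ f]) (intro continuous_intros)
  qed
  show ?thesis
  proof (rule has_bochner_integral.intros[where s = "\<lambda>i a. ?L (s i a)"])
    show "Bochner_Integration.simple_bochner_integrable M (\<lambda>a. ?L (s i a))" for i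
      by (rule simple_bochner_integrable_compose2[where p = "\<lambda>u v. ?L u", OF _ s s]) simp
    show "(\<lambda>i. \<integral>\<^sup>+ a. ennreal (norm (?L (f a) - ?L (s i a))) \<partial>M) \<longlonglongrightarrow> 0"
    proof (rule tendsto_sandwich[of "\<lambda>_. 0" _ _
          "\<lambda>i. ennreal (norm y) * (\<integral>\<^sup>+ a. ennreal (norm (f a - s i a)) \<partial>M)"])
      have "(\<integral>\<^sup>+ a. ennreal (norm (?L (f a) - ?L (s i a))) \<partial>M)
          \<le> (\<integral>\<^sup>+ a. ennreal (norm y) * ennreal (norm (f a - s i a)) \<partial>M)" for i
        using cmod_ip_le[of _ y]
        by (intro nn_integral_mono)
          (simp add: ip.diff_left[symmetric] ennreal_mult[symmetric] mult.commute[of "norm y"])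
      then show "\<forall>\<^sub>F i in sequentially. (\<integral>\<^sup>+ a. ennreal (norm (?L (f a) - ?L (s i a))) \<partial>M)
          \<le> ennreal (norm y) * (\<integral>\<^sup>+ a. ennreal (norm (f a - s i a)) \<partial>M)"
        using norm_meas by (simp add: nn_integral_cmult)
      show "(\<lambda>i. ennreal (norm y) * (\<integral>\<^sup>+ a. ennreal (norm (f a - s i a)) \<partial>M)) \<longlonglongrightarrow> 0"
        using ennreal_tendsto_cmult[OF _ lim, of "ennreal (norm y)"] by simp
    qed simp_all
    show "(\<lambda>i. Bochner_Integration.simple_bochner_integral M (\<lambda>a. ?L (s i a))) \<longlonglongrightarrow> ?L z"
      using L.tendsto[OF int] by (simp add: simple_bochner_integral_linear[OF L.linear_axioms s])
  qed (rule meas)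
qed

end

section \<open>The total variation as a measure\<close>

lemma cabv_sums:
  "\<mu> \<in> cabv \<Longrightarrow> range A \<subseteq> sets borel \<Longrightarrow> disjoint_family A \<Longrightarrow> (\<lambda>i::nat. \<mu> (A i)) sums \<mu> (\<Union>i. A i)"
  by (simp add: cabv_def)

lemma cabv_outside: "\<mu> \<in> cabv \<Longrightarrow> A \<notin> sets borel \<Longrightarrow> \<mu> A = 0"
  by (simp add: cabv_def)

lemma cabv_empty [simp]:
  assumes "\<mu> \<in> cabv" shows "\<mu> {} = 0"
proof -
  have "(\<lambda>i::nat. \<mu> {}) sums \<mu> (\<Union>i::nat. {})"
    using assms by (intro cabv_sums) (auto simp: disjoint_family_on_def)
  then show ?thesis
    using summable_LIMSEQ_zero sums_summable by (metis LIMSEQ_const_iff)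
qed

lemma cabv_Un:
  assumes "\<mu> \<in> cabv" "A \<in> sets borel" "B \<in> sets borel" "A \<inter> B = {}"
  shows "\<mu> (A \<union> B) = \<mu> A + \<mu> B"
proof -
  have "(\<lambda>i. \<mu> (binaryset A B i)) sums \<mu> (\<Union>i. binaryset A B i)"
    using assms by (intro cabv_sums)
      (auto simp: binaryset_def disjoint_family_on_def split: if_splits)
  then show ?thesis
    using binaryset_sums[of \<mu> A B] assms sums_unique2 by (fastforce simp: UN_binaryset_eq)
qed

lemma cabv_finite_Union:
  assumes mu: "\<mu> \<in> cabv" and "finite I" "\<And>i. i \<in> I \<Longrightarrow> A i \<in> sets borel" "disjoint_family_on A I"
  shows "\<mu> (\<Union>i\<in>I. A i) = (\<Sum>i\<in>I. \<mu> (A i))"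
  using assms(2-)
proof (induction I rule: finite_induct)
  case (insert x F)
  have "A x \<inter> (\<Union>i\<in>F. A i) = {}"
    using insert.hyps insert.prems(2) by (fastforce simp: disjoint_family_on_def)
  then have "\<mu> (A x \<union> (\<Union>i\<in>F. A i)) = \<mu> (A x) + \<mu> (\<Union>i\<in>F. A i)"
    using insert by (intro cabv_Un[OF mu] sets.finite_UN) auto
  then show ?case
    using insert by (auto simp: disjoint_family_on_def)
qed (simp add: mu)

lemma cabv_Compl:
  assumes "\<mu> \<in> cabv" "A \<in> sets borel" shows "\<mu> (- A) = \<mu> UNIV - \<mu> A"
  using cabv_Un[OF assms(1), of A "- A"] assms(2) borel_comp[of A] by (simp add: algebra_simps)

lemma sum_norm_le_total_variation:
  assumes "finite P" "P \<subseteq> sets borel" "disjoint P" "\<Union>P = A"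
  shows "(\<Sum>B\<in>P. ennreal (norm (\<mu> B))) \<le> total_variation \<mu> A"
  unfolding total_variation_def using assms by (intro SUP_upper) auto

lemma norm_le_total_variation:
  "A \<in> sets borel \<Longrightarrow> ennreal (norm (\<mu> A)) \<le> total_variation \<mu> A"
  using sum_norm_le_total_variation[of "{A}" A \<mu>] by simp

text \<open>The empty set may occur in several of the partitions that are combined here; it carries no mass.\<close>

lemma total_variation_superadditive:
  assumes mu: "\<mu> \<in> cabv" and disj: "A \<inter> B = {}" and A: "A \<in> sets borel" and B: "B \<in> sets borel"
  shows "total_variation \<mu> A + total_variation \<mu> B \<le> total_variation \<mu> (A \<union> B)"
proof -
  let ?part = "\<lambda>A. {P. finite P \<and> P \<subseteq> sets borel \<and> disjoint P \<and> \<Union>P = A}"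
  let ?s = "\<lambda>P. \<Sum>B\<in>P. ennreal (norm (\<mu> B))"
  have ne: "?part A \<noteq> {}" if "A \<in> sets borel" for A :: "'a set"
    using that by (auto intro!: exI[of _ "{A}"])
  have "?s P + ?s Q \<le> total_variation \<mu> (A \<union> B)" if "P \<in> ?part A" "Q \<in> ?part B" for P Q
  proof -
    have PQ: "finite P" "finite Q" "P \<subseteq> sets borel" "Q \<subseteq> sets borel" "disjoint P" "disjoint Q"
      "\<Union>P = A" "\<Union>Q = B" using that by auto
    have "C = {}" if "C \<in> P \<inter> Q" for C using that PQ disj by fastforce
    then have "\<forall>C\<in>P \<inter> Q. ennreal (norm (\<mu> C)) = 0" using mu by fastforce
    then have "?s P + ?s Q = ?s (P \<union> Q)"
      using PQ by (intro sum.union_inter_neutral[symmetric]) auto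
    also have "\<dots> \<le> total_variation \<mu> (A \<union> B)"
      using PQ disj by (intro sum_norm_le_total_variation disjoint_union) auto
    finally show ?thesis .
  qed
  then have "(SUP P\<in>?part A. ?s P + ?s Q) \<le> total_variation \<mu> (A \<union> B)" if "Q \<in> ?part B" for Q
    using that by (intro SUP_least) blast
  then have "total_variation \<mu> A + ?s Q \<le> total_variation \<mu> (A \<union> B)" if "Q \<in> ?part B" for Q
    using that unfolding total_variation_def[of \<mu> A] ennreal_SUP_add_left[OF ne[OF A], symmetric] by blast
  then have "(SUP Q\<in>?part B. total_variation \<mu> A + ?s Q) \<le> total_variation \<mu> (A \<union> B)"
    by (intro SUP_least) blast
  then show ?thesis
    unfolding total_variation_def[of \<mu> B] ennreal_SUP_add_right[OF ne[OF B]] .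
qed

lemma total_variation_mono:
  assumes "\<mu> \<in> cabv" "A \<subseteq> B" "A \<in> sets borel" "B \<in> sets borel"
  shows "total_variation \<mu> A \<le> total_variation \<mu> B"
proof -
  have "total_variation \<mu> A \<le> total_variation \<mu> A + total_variation \<mu> (B - A)" by simp
  also have "\<dots> \<le> total_variation \<mu> (A \<union> (B - A))"
    using assms by (intro total_variation_superadditive) auto
  also have "A \<union> (B - A) = B" using assms by auto
  finally show ?thesis .
qed

text \<open>
  A finite partition of the union cuts each \<open>A i\<close> into finitely many pieces, which gives one
  inequality; superadditivity gives the other one.
\<close>

lemma total_variation_sigma_additive:
  assumes mu: "\<mu> \<in> cabv" and A: "range A \<subseteq> sets borel" and disj: "disjoint_family A"
  shows "(\<Sum>i. total_variation \<mu> (A i)) = total_variation \<mu> (\<Union>i::nat. A i)"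
proof (rule antisym)
  have A_sets [simp]: "A i \<in> sets borel" for i using A by auto
  have "(\<Sum>i<n. total_variation \<mu> (A i)) \<le> total_variation \<mu> (\<Union>i<n. A i)" for n
  proof (induction n)
    case (Suc n)
    have "(\<Sum>i<Suc n. total_variation \<mu> (A i))
        \<le> total_variation \<mu> (\<Union>i<n. A i) + total_variation \<mu> (A n)"
      using Suc by (simp add: add_right_mono)
    also have "\<dots> \<le> total_variation \<mu> ((\<Union>i<n. A i) \<union> A n)"
      using disj by (intro total_variation_superadditive[OF mu])
        (auto simp: disjoint_family_on_def, (metis IntI empty_iff less_irrefl))
    also have "(\<Union>i<n. A i) \<union> A n = (\<Union>i<Suc n. A i)" by (auto simp: less_Suc_eq)
    finally show ?case .
  qed simp
  also have "total_variation \<mu> (\<Union>i<n. A i) \<le> total_variation \<mu> (\<Union>i. A i)" for n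
    by (intro total_variation_mono[OF mu]) auto
  finally show "(\<Sum>i. total_variation \<mu> (A i)) \<le> total_variation \<mu> (\<Union>i. A i)"
    by (intro suminf_le_const) auto
  show "total_variation \<mu> (\<Union>i. A i) \<le> (\<Sum>i. total_variation \<mu> (A i))"
    unfolding total_variation_def[of \<mu> "\<Union>i. A i"]
  proof (rule SUP_least)
    fix P assume "P \<in> {P. finite P \<and> P \<subseteq> sets borel \<and> disjoint P \<and> \<Union>P = (\<Union>i. A i)}"
    then have P: "finite P" "P \<subseteq> sets borel" "disjoint P" "\<Union>P = (\<Union>i. A i)" by auto
    have "ennreal (norm (\<mu> B)) \<le> (\<Sum>i. ennreal (norm (\<mu> (B \<inter> A i))))" if "B \<in> P" for B
    proof -
      have "(\<lambda>i. \<mu> (B \<inter> A i)) sums \<mu> (\<Union>i. B \<inter> A i)"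
      proof (rule cabv_sums[OF mu])
        show "disjoint_family (\<lambda>i. B \<inter> A i)"
          using disj by (auto simp: disjoint_family_on_def disjoint_iff)
      qed (use that P in auto)
      moreover have "(\<Union>i. B \<inter> A i) = B" using that P by auto
      ultimately have *: "(\<lambda>i. \<mu> (B \<inter> A i)) sums \<mu> B" by simp
      then have "(\<lambda>n. norm (\<Sum>i<n. \<mu> (B \<inter> A i))) \<longlonglongrightarrow> norm (\<mu> B)"
        unfolding sums_def by (intro tendsto_norm)
      then have "(\<lambda>n. ennreal (norm (\<Sum>i<n. \<mu> (B \<inter> A i)))) \<longlonglongrightarrow> ennreal (norm (\<mu> B))"
        by (rule tendsto_ennrealI)
      moreover have "ennreal (norm (\<Sum>i<n. \<mu> (B \<inter> A i))) \<le> (\<Sum>i. ennreal (norm (\<mu> (B \<inter> A i))))" for n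
      proof -
        have "ennreal (norm (\<Sum>i<n. \<mu> (B \<inter> A i))) \<le> (\<Sum>i<n. ennreal (norm (\<mu> (B \<inter> A i))))"
          by (simp add: norm_sum sum_nonneg ennreal_leI)
        also have "\<dots> \<le> (\<Sum>i. ennreal (norm (\<mu> (B \<inter> A i))))" by (intro sum_le_suminf) auto
        finally show ?thesis .
      qed
      ultimately show ?thesis
        by (intro tendsto_upperbound[where F = sequentially and f = "\<lambda>n. ennreal (norm (\<Sum>i<n. \<mu> (B \<inter> A i)))"]) auto
    qed
    then have "(\<Sum>B\<in>P. ennreal (norm (\<mu> B))) \<le> (\<Sum>B\<in>P. \<Sum>i. ennreal (norm (\<mu> (B \<inter> A i))))"
      by (intro sum_mono)
    also have "\<dots> = (\<Sum>i. \<Sum>B\<in>P. ennreal (norm (\<mu> (B \<inter> A i))))"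
      by (intro suminf_sum[symmetric]) auto
    also have "\<dots> \<le> (\<Sum>i. total_variation \<mu> (A i))"
    proof (intro suminf_le allI)
      fix i
      have "ennreal (norm (\<mu> (B \<inter> A i))) = 0" if "B \<in> P" "C \<in> P" "B \<noteq> C" "B \<inter> A i = C \<inter> A i" for B C
      proof -
        have "B \<inter> A i = {}" using that P(3) unfolding disjoint_def by blast
        then show ?thesis by (simp add: cabv_empty[OF mu])
      qed
      then have "(\<Sum>B\<in>P. ennreal (norm (\<mu> (B \<inter> A i)))) = (\<Sum>C\<in>(\<lambda>B. B \<inter> A i) ` P. ennreal (norm (\<mu> C)))"
        by (subst sum.reindex_nontrivial[OF P(1)]) simp_all
      also have "\<dots> \<le> total_variation \<mu> (A i)"
      proof (rule sum_norm_le_total_variation)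
        show "disjoint ((\<lambda>B. B \<inter> A i) ` P)"
          using P(3) unfolding disjoint_def by blast
        show "\<Union>((\<lambda>B. B \<inter> A i) ` P) = A i" using P(4) by blast
      qed (use P(1,2) in auto)
      finally show "(\<Sum>B\<in>P. ennreal (norm (\<mu> (B \<inter> A i)))) \<le> total_variation \<mu> (A i)" .
    qed auto
    finally show "(\<Sum>B\<in>P. ennreal (norm (\<mu> B))) \<le> (\<Sum>i. total_variation \<mu> (A i))" .
  qed
qed

definition tv_measure :: "('t::topological_space set \<Rightarrow> 'x::real_normed_vector) \<Rightarrow> 't measure" where
  "tv_measure \<mu> = measure_of UNIV (sets borel) (total_variation \<mu>)"

lemma sets_tv_measure [simp, measurable_cong]: "sets (tv_measure \<mu>) = sets borel"
  unfolding tv_measure_def using sets.sigma_sets_eq[of borel] by simp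

lemma space_tv_measure [simp]: "space (tv_measure \<mu>) = UNIV"
  unfolding tv_measure_def by (simp add: space_measure_of_conv)

lemma emeasure_tv_measure:
  assumes mu: "\<mu> \<in> cabv" and A: "A \<in> sets borel"
  shows "emeasure (tv_measure \<mu>) A = total_variation \<mu> A"
  unfolding tv_measure_def
proof (rule emeasure_measure_of_sigma)
  have "total_variation \<mu> {} \<le> 0"
    unfolding total_variation_def
  proof (rule SUP_least)
    fix P :: "'a set set" assume "P \<in> {P. finite P \<and> P \<subseteq> sets borel \<and> disjoint P \<and> \<Union>P = {}}"
    then have "\<forall>B\<in>P. B = {}" by auto
    then have "(\<Sum>B\<in>P. ennreal (norm (\<mu> B))) = (\<Sum>B\<in>P. ennreal (norm (\<mu> {})))" by (intro sum.cong) auto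
    also have "\<dots> = 0" using cabv_empty[OF mu] by simp
    finally have "(\<Sum>B\<in>P. ennreal (norm (\<mu> B))) = 0" .
    then show "(\<Sum>B\<in>P. ennreal (norm (\<mu> B))) \<le> 0" by simp
  qed
  then show "positive (sets borel) (total_variation \<mu>)" by (simp add: positive_def)
  show "countably_additive (sets borel) (total_variation \<mu>)"
    unfolding countably_additive_def using total_variation_sigma_additive[OF mu] by blast
  show "sigma_algebra UNIV (sets (borel :: 'a measure))"
    using sets.sigma_algebra_axioms[of "borel :: 'a measure"] by simp
qed (rule A)

lemma finite_measure_tv_measure:
  assumes "\<mu> \<in> cabv" shows "finite_measure (tv_measure \<mu>)"
proof
  show "emeasure (tv_measure \<mu>) (space (tv_measure \<mu>)) \<noteq> \<infinity>"
    using assms by (simp add: emeasure_tv_measure cabv_def less_top)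
qed

lemma norm_le_tv_measure:
  assumes "\<mu> \<in> cabv" shows "norm (\<mu> A) \<le> measure (tv_measure \<mu>) A"
proof (cases "A \<in> sets borel")
  case True
  interpret finite_measure "tv_measure \<mu>" by (rule finite_measure_tv_measure[OF assms])
  have "ennreal (norm (\<mu> A)) \<le> ennreal (measure (tv_measure \<mu>) A)"
    using norm_le_total_variation[OF True] emeasure_tv_measure[OF assms True]
    by (simp add: emeasure_eq_measure)
  then show ?thesis by simp
qed (simp add: cabv_outside[OF assms])

text \<open>
  Domination by a finite measure turns finite additivity into countable additivity and bounds the
  variation.
\<close>

lemma cabvI:
  fixes \<nu> :: "'t::topological_space set \<Rightarrow> 'x::real_normed_vector"
  assumes out: "\<And>A. A \<notin> sets borel \<Longrightarrow> \<nu> A = 0"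
    and add: "\<And>A B. A \<in> sets borel \<Longrightarrow> B \<in> sets borel \<Longrightarrow> A \<inter> B = {} \<Longrightarrow> \<nu> (A \<union> B) = \<nu> A + \<nu> B"
    and N: "finite_measure N" "sets N = sets borel"
    and le: "\<And>A. A \<in> sets borel \<Longrightarrow> norm (\<nu> A) \<le> measure N A"
  shows "\<nu> \<in> cabv"
proof -
  interpret N: finite_measure N by fact
  have "\<nu> {} = 0" using add[of "{}" "{}"] by simp
  have sums: "(\<lambda>i. \<nu> (A i)) sums \<nu> (\<Union>i. A i)"
    if A: "range A \<subseteq> sets borel" "disjoint_family A" for A :: "nat \<Rightarrow> 't set"
  proof -
    have A_sets [simp]: "A i \<in> sets borel" for i using A by auto
    have fin: "\<nu> (\<Union>i<n. A i) = (\<Sum>i<n. \<nu> (A i))" for n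
    proof (induction n)
      case (Suc n)
      have "(\<Union>i<n. A i) \<inter> A n = {}"
        using A(2) by (auto simp: disjoint_family_on_def) (metis IntI empty_iff less_irrefl)
      then have "\<nu> ((\<Union>i<n. A i) \<union> A n) = \<nu> (\<Union>i<n. A i) + \<nu> (A n)"
        by (intro add) auto
      also have "(\<Union>i<n. A i) \<union> A n = (\<Union>i<Suc n. A i)" by (auto simp: less_Suc_eq)
      finally show ?case using Suc by simp
    qed (simp add: \<open>\<nu> {} = 0\<close>)
    define B where "B n = (\<Union>i. A i) - (\<Union>i<n. A i)" for n
    have B_sets: "B n \<in> sets borel" for n unfolding B_def by (intro sets.Diff sets.countable_nat_UN sets.finite_UN) auto
    have split: "\<nu> (\<Union>i. A i) = (\<Sum>i<n. \<nu> (A i)) + \<nu> (B n)" for n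
    proof -
      have "\<nu> ((\<Union>i<n. A i) \<union> B n) = \<nu> (\<Union>i<n. A i) + \<nu> (B n)"
        by (intro add B_sets) (auto simp: B_def)
      also have "(\<Union>i<n. A i) \<union> B n = (\<Union>i. A i)" by (auto simp: B_def)
      finally show ?thesis by (simp add: fin)
    qed
    have "(\<lambda>n. measure N (B n)) \<longlonglongrightarrow> measure N (\<Inter>n. B n)"
      using B_sets by (intro N.finite_Lim_measure_decseq) (auto simp: N(2) B_def decseq_def)
    moreover have "(\<Inter>n. B n) = {}" by (auto simp: B_def)
    ultimately have "(\<lambda>n. measure N (B n)) \<longlonglongrightarrow> 0" by simp
    then have "(\<lambda>n. \<nu> (B n)) \<longlonglongrightarrow> 0"
      by (rule Lim_null_comparison[rotated]) (simp add: le B_sets)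
    then have "(\<lambda>n. \<nu> (\<Union>i. A i) - \<nu> (B n)) \<longlonglongrightarrow> \<nu> (\<Union>i. A i) - 0"
      by (intro tendsto_intros)
    moreover have "\<nu> (\<Union>i. A i) - \<nu> (B n) = (\<Sum>i<n. \<nu> (A i))" for n using split[of n] by simp
    ultimately show ?thesis by (simp add: sums_def)
  qed
  have "total_variation \<nu> UNIV \<le> emeasure N UNIV"
    unfolding total_variation_def
  proof (rule SUP_least)
    fix P :: "'t set set" assume "P \<in> {P. finite P \<and> P \<subseteq> sets borel \<and> disjoint P \<and> \<Union>P = UNIV}"
    then have P: "finite P" "P \<subseteq> sets borel" "disjoint P" "\<Union>P = UNIV" by auto
    have "(\<Sum>B\<in>P. ennreal (norm (\<nu> B))) \<le> (\<Sum>B\<in>P. emeasure N B)"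
      using P le by (intro sum_mono) (auto simp: N.emeasure_eq_measure intro!: ennreal_leI)
    also have "\<dots> = emeasure N (\<Union>B\<in>P. B)"
      using P by (intro sum_emeasure) (auto simp: N(2) disjoint_family_on_def disjoint_def)
    finally show "(\<Sum>B\<in>P. ennreal (norm (\<nu> B))) \<le> emeasure N UNIV" using P by simp
  qed
  also have "\<dots> < \<infinity>" by (simp add: N.emeasure_eq_measure)
  finally show ?thesis using out sums by (simp add: cabv_def)
qed

section \<open>The uniform integral\<close>

definition unif_simple :: "('t::topological_space \<Rightarrow> 'x::real_normed_vector) \<Rightarrow> bool" where
  "unif_simple f \<longleftrightarrow> (\<exists>s. (\<forall>m::nat. simple_function borel (s m)) \<and> uniform_limit UNIV s f sequentially)"

lemma unif_simple_simple: "simple_function borel f \<Longrightarrow> unif_simple f"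
  unfolding unif_simple_def by (intro exI[of _ "\<lambda>_. f"]) (auto intro: uniform_limit_const)

lemma unif_simple_add: "unif_simple f \<Longrightarrow> unif_simple g \<Longrightarrow> unif_simple (\<lambda>t. f t + g t)"
  unfolding unif_simple_def
proof (elim exE conjE)
  fix s u assume "\<forall>m::nat. simple_function borel (s m)" "uniform_limit UNIV s f sequentially"
    "\<forall>m::nat. simple_function borel (u m)" "uniform_limit UNIV u g sequentially"
  then show "\<exists>s. (\<forall>m::nat. simple_function borel (s m)) \<and>
      uniform_limit UNIV s (\<lambda>t. f t + g t) sequentially"
    by (intro exI[of _ "\<lambda>m t. s m t + u m t"])
      (auto intro: simple_function_compose2 uniform_limit_add)
qed

lemma unif_simple_scaleR: "unif_simple f \<Longrightarrow> unif_simple (\<lambda>t. r *\<^sub>R f t)"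
  unfolding unif_simple_def
proof (elim exE conjE)
  fix s assume s: "\<forall>m::nat. simple_function borel (s m)" "uniform_limit UNIV s f sequentially"
  have "uniform_limit UNIV (\<lambda>m t. r *\<^sub>R s m t) (\<lambda>t. r *\<^sub>R f t) sequentially"
    using bounded_linear.uniform_limit[OF bounded_linear_scaleR_right s(2)] .
  then show "\<exists>s. (\<forall>m::nat. simple_function borel (s m)) \<and>
      uniform_limit UNIV s (\<lambda>t. r *\<^sub>R f t) sequentially"
    using s(1) by (intro exI[of _ "\<lambda>m t. r *\<^sub>R s m t"])
      (auto intro: simple_function_compose1)
qed

lemma unif_simple_diff: "unif_simple f \<Longrightarrow> unif_simple g \<Longrightarrow> unif_simple (\<lambda>t. f t - g t)"
  using unif_simple_add[OF _ unif_simple_scaleR[of g "-1"], of f] by simp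

lemma unif_simple_measurable:
  assumes "unif_simple f" shows "f \<in> borel_measurable borel"
proof -
  obtain s where "\<forall>m::nat. simple_function borel (s m)" "uniform_limit UNIV s f sequentially"
    using assms unfolding unif_simple_def by blast
  then have "s i \<in> borel_measurable borel" "(\<lambda>i. s i t) \<longlonglongrightarrow> f t" for i t
    by (simp_all add: borel_measurable_simple_function tendsto_uniform_limitI)
  then show ?thesis by (rule borel_measurable_LIMSEQ_metric)
qed

lemma simple_function_bounded:
  fixes f :: "'t \<Rightarrow> 'x::real_normed_vector"
  assumes "simple_function M f" shows "\<exists>C. \<forall>t\<in>space M. norm (f t) \<le> C"
proof -
  have "finite ((\<lambda>t. norm (f t)) ` space M)"
    using simple_functionD(1)[OF assms] by (metis finite_imageI image_image)
  then show ?thesis by (meson Max_ge imageI)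
qed

lemma unif_simple_bounded:
  assumes "unif_simple f" shows "\<exists>C. \<forall>t. norm (f t) \<le> C"
proof -
  obtain s where s: "\<forall>m::nat. simple_function borel (s m)" "uniform_limit UNIV s f sequentially"
    using assms unfolding unif_simple_def by blast
  obtain m where m: "\<And>t. dist (s m t) (f t) < 1"
    using uniform_limitD[OF s(2), of 1] by (auto simp: eventually_sequentially)
  obtain C where C: "\<And>t. norm (s m t) \<le> C"
    using simple_function_bounded[of borel "s m"] s(1) by auto
  have "norm (f t) \<le> C + 1" for t
  proof -
    have "norm (f t) \<le> norm (s m t) + dist (s m t) (f t)"
      by (metis add.commute dist_commute dist_norm norm_triangle_sub)
    then show ?thesis using C[of t] m[of t] by linarith
  qed
  then show ?thesis by blast
qed

lemma unif_simple_norm_integrable: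
  assumes "\<mu> \<in> cabv" "unif_simple f"
  shows "integrable (tv_measure \<mu>) (\<lambda>t. norm (f t))"
proof -
  interpret finite_measure "tv_measure \<mu>" by (rule finite_measure_tv_measure[OF assms(1)])
  obtain C where "\<And>t. norm (f t) \<le> C" using unif_simple_bounded[OF assms(2)] by blast
  then show ?thesis
    using unif_simple_measurable[OF assms(2)] by (intro integrable_const_bound[of _ C]) auto
qed

context hilbert_space_over
begin

text \<open>
  The sum defining the integral of a simple function may be taken over the level sets of any simple
  function \<open>g\<close> through which it factors, and over any finite set containing the values of \<open>g\<close>.
\<close>

lemma simple_sint_compose:
  assumes mu: "\<mu> \<in> cabv" and g: "simple_function borel g" and Y: "finite Y" "range g \<subseteq> Y"
  shows "simple_sint ip (\<lambda>t. v (g t)) \<mu> = (\<Sum>y\<in>Y. ip (v y) (\<mu> (g -` {y})))"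
proof -
  have g_sets: "g -` B \<in> sets borel" for B
    using simple_functionD(2)[OF g, of B] by simp
  have fin: "finite (range g)" using Y by (rule finite_subset[rotated])
  have level: "\<mu> ((\<lambda>t. v (g t)) -` {x}) = (\<Sum>y\<in>{y\<in>range g. v y = x}. \<mu> (g -` {y}))" for x
  proof -
    have "(\<lambda>t. v (g t)) -` {x} = (\<Union>y\<in>{y\<in>range g. v y = x}. g -` {y})" by auto
    then show ?thesis
      using fin g_sets by (simp, intro cabv_finite_Union[OF mu]) (auto simp: disjoint_family_on_def)
  qed
  have "simple_sint ip (\<lambda>t. v (g t)) \<mu>
      = (\<Sum>x\<in>v ` range g. \<Sum>y\<in>{y\<in>range g. v y = x}. ip (v y) (\<mu> (g -` {y})))"
    unfolding simple_sint_def level ip.sum_right image_image by (intro sum.cong refl) auto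
  also have "\<dots> = (\<Sum>y\<in>range g. ip (v y) (\<mu> (g -` {y})))"
    using fin by (intro sum.group) auto
  also have "\<dots> = (\<Sum>y\<in>Y. ip (v y) (\<mu> (g -` {y})))"
  proof (rule sum.mono_neutral_left[OF Y])
    show "\<forall>y\<in>Y - range g. ip (v y) (\<mu> (g -` {y})) = 0"
    proof
      fix y assume "y \<in> Y - range g"
      then have "g -` {y} = {}" by auto
      then show "ip (v y) (\<mu> (g -` {y})) = 0" using mu by (simp add: ip.zero_right)
    qed
  qed
  finally show ?thesis .
qed

lemma simple_sint_add:
  assumes mu: "\<mu> \<in> cabv" and f: "simple_function borel f" and g: "simple_function borel g"
  shows "simple_sint ip (\<lambda>t. f t + g t) \<mu> = simple_sint ip f \<mu> + simple_sint ip g \<mu>"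
proof -
  let ?h = "\<lambda>t. (f t, g t)"
  have h: "simple_function borel ?h" by (rule simple_function_Pair[OF f g])
  have fin: "finite (range ?h)" using simple_functionD(1)[OF h] by simp
  show ?thesis
    using simple_sint_compose[OF mu h fin, of "\<lambda>p. fst p + snd p"]
      simple_sint_compose[OF mu h fin, of fst] simple_sint_compose[OF mu h fin, of snd]
    by (simp add: ip.add_left sum.distrib)
qed

lemma simple_sint_scaleR:
  assumes mu: "\<mu> \<in> cabv" and f: "simple_function borel f"
  shows "simple_sint ip (\<lambda>t. r *\<^sub>R f t) \<mu> = r *\<^sub>R simple_sint ip f \<mu>"
proof -
  have fin: "finite (range f)" using simple_functionD(1)[OF f] by simp
  show ?thesis
    using simple_sint_compose[OF mu f fin, of "\<lambda>x. r *\<^sub>R x"]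
    by (simp add: simple_sint_def ip.scaleR_left scaleR_right.sum)
qed

lemma simple_sint_diff:
  assumes mu: "\<mu> \<in> cabv" and f: "simple_function borel f" and g: "simple_function borel g"
  shows "simple_sint ip (\<lambda>t. f t - g t) \<mu> = simple_sint ip f \<mu> - simple_sint ip g \<mu>"
proof -
  have "simple_function borel (\<lambda>t. (-1) *\<^sub>R g t)" using g by (rule simple_function_compose1)
  then show ?thesis
    using simple_sint_add[OF mu f, of "\<lambda>t. (-1) *\<^sub>R g t"] simple_sint_scaleR[OF mu g, of "-1"]
    by simp
qed

lemma cmod_simple_sint_le_integral:
  assumes mu: "\<mu> \<in> cabv" and f: "simple_function borel f"
  shows "cmod (simple_sint ip f \<mu>) \<le> (\<integral>t. norm (f t) \<partial>tv_measure \<mu>)"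
proof -
  interpret finite_measure "tv_measure \<mu>" by (rule finite_measure_tv_measure[OF mu])
  have fin: "finite (range f)" using simple_functionD(1)[OF f] by simp
  have f_sets: "f -` {x} \<in> sets borel" for x
    using simple_functionD(2)[OF f, of "{x}"] by simp
  have "cmod (simple_sint ip f \<mu>) \<le> (\<Sum>x\<in>range f. norm x * norm (\<mu> (f -` {x})))"
    unfolding simple_sint_def by (rule order_trans[OF norm_sum sum_mono]) (rule cmod_ip_le)
  also have "\<dots> \<le> (\<Sum>x\<in>range f. norm x * measure (tv_measure \<mu>) (f -` {x}))"
    by (intro sum_mono mult_left_mono norm_le_tv_measure[OF mu]) simp
  also have "\<dots> = (\<Sum>x\<in>range f. \<integral>t. norm x * indicator (f -` {x}) t \<partial>tv_measure \<mu>)"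
    using f_sets by simp
  also have "\<dots> = (\<integral>t. (\<Sum>x\<in>range f. norm x * indicator (f -` {x}) t) \<partial>tv_measure \<mu>)"
    using f_sets by (intro Bochner_Integration.integral_sum[symmetric]) (auto simp: emeasure_finite less_top[symmetric])
  also have "(\<lambda>t. \<Sum>x\<in>range f. norm x * indicator (f -` {x}) t) = (\<lambda>t. norm (f t))"
  proof
    fix t
    have "(\<Sum>x\<in>range f. norm x * indicator (f -` {x}) t) = (\<Sum>x\<in>range f. if x = f t then norm x else 0)"
      by (intro sum.cong) (auto simp: indicator_def)
    also have "\<dots> = norm (f t)" using fin by simp
    finally show "(\<Sum>x\<in>range f. norm x * indicator (f -` {x}) t) = norm (f t)" .
  qed
  finally show ?thesis .
qed

lemma cmod_simple_sint_le:
  assumes mu: "\<mu> \<in> cabv" and f: "simple_function borel f" and C: "\<And>t. norm (f t) \<le> C"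
  shows "cmod (simple_sint ip f \<mu>) \<le> C * measure (tv_measure \<mu>) UNIV"
proof -
  interpret finite_measure "tv_measure \<mu>" by (rule finite_measure_tv_measure[OF mu])
  have "(\<integral>t. norm (f t) \<partial>tv_measure \<mu>) \<le> (\<integral>t. C \<partial>tv_measure \<mu>)"
    using C by (intro integral_mono unif_simple_norm_integrable[OF mu] unif_simple_simple f) auto
  then show ?thesis using cmod_simple_sint_le_integral[OF mu f] by (simp add: mult.commute)
qed

text \<open>
  Two sequences converging uniformly to \<open>f\<close> are eventually uniformly close, and by the finite variation
  of \<open>\<mu>\<close> so are their integrals. Taking both sequences equal gives convergence; taking them different
  shows that the limit depends on \<open>f\<close> only.
\<close>

lemma simple_sint_tendsto_sint:
  assumes mu: "\<mu> \<in> cabv" and s: "\<And>m::nat. simple_function borel (s m)"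
    and lim: "uniform_limit UNIV s f sequentially"
  shows "(\<lambda>m. simple_sint ip (s m) \<mu>) \<longlonglongrightarrow> sint ip f \<mu>"
proof -
  let ?V = "measure (tv_measure \<mu>) UNIV"
  have close: "\<exists>N. \<forall>m\<ge>N. \<forall>k\<ge>N. cmod (simple_sint ip (s m) \<mu> - simple_sint ip (u k) \<mu>) < e"
    if e: "0 < e" and s: "\<And>m::nat. simple_function borel (s m)" "uniform_limit UNIV s f sequentially"
      and u: "\<And>m::nat. simple_function borel (u m)" "uniform_limit UNIV u f sequentially" for e s u
  proof -
    define d where "d = e / (2 * (?V + 1))"
    have V: "0 \<le> ?V" by simp
    then have d: "0 < d" using e unfolding d_def by (intro divide_pos_pos mult_pos_pos) linarith+
    obtain N where N: "\<And>m t. N \<le> m \<Longrightarrow> dist (s m t) (f t) < d" "\<And>m t. N \<le> m \<Longrightarrow> dist (u m t) (f t) < d"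
      using eventually_conj[OF uniform_limitD[OF s(2) d] uniform_limitD[OF u(2) d]]
      by (auto simp: eventually_sequentially)
    have "cmod (simple_sint ip (s m) \<mu> - simple_sint ip (u k) \<mu>) < e" if "N \<le> m" "N \<le> k" for m k
    proof -
      have "norm (s m t - u k t) \<le> 2 * d" for t
        using N(1)[OF that(1), of t] N(2)[OF that(2), of t] dist_triangle2[of "s m t" "u k t" "f t"]
        by (simp add: dist_norm)
      then have "cmod (simple_sint ip (\<lambda>t. s m t - u k t) \<mu>) \<le> 2 * d * ?V"
        by (rule cmod_simple_sint_le[OF mu simple_function_diff[OF s(1) u(1)]])
      also have "\<dots> < 2 * d * (?V + 1)" using d by simp
      also have "\<dots> = e"
      proof -
        have "2 * (e / (2 * (v + 1))) * (v + 1) = e" if "0 \<le> v" for v :: real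
          using that by (simp add: field_simps)
        then show ?thesis unfolding d_def using V by blast
      qed
      finally show ?thesis using s u by (simp add: simple_sint_diff[OF mu])
    qed
    then show ?thesis by blast
  qed
  have "Cauchy (\<lambda>m. simple_sint ip (s m) \<mu>)"
    using close[OF _ s lim s lim] by (intro CauchyI) blast
  then obtain l where l: "(\<lambda>m. simple_sint ip (s m) \<mu>) \<longlonglongrightarrow> l"
    using Cauchy_convergent convergent_def by blast
  have "has_sint ip f \<mu> l" unfolding has_sint_def using s lim l by blast
  moreover have "l' = l" if l': "has_sint ip f \<mu> l'" for l'
  proof -
    obtain u where u: "\<And>m::nat. simple_function borel (u m)" "uniform_limit UNIV u f sequentially"
      and lu: "(\<lambda>m. simple_sint ip (u m) \<mu>) \<longlonglongrightarrow> l'"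
      using l' unfolding has_sint_def by blast
    have "(\<lambda>m. simple_sint ip (s m) \<mu> - simple_sint ip (u m) \<mu>) \<longlonglongrightarrow> 0"
      unfolding LIMSEQ_iff using close[OF _ s lim u] by (metis diff_zero)
    then have "l - l' = 0" using tendsto_diff[OF l lu] LIMSEQ_unique by blast
    then show ?thesis by simp
  qed
  ultimately have "sint ip f \<mu> = l" unfolding sint_def by (rule the_equality)
  then show ?thesis using l by simp
qed

lemma sint_simple:
  "\<mu> \<in> cabv \<Longrightarrow> simple_function borel f \<Longrightarrow> sint ip f \<mu> = simple_sint ip f \<mu>"
  using simple_sint_tendsto_sint[of \<mu> "\<lambda>_. f" f]
  by (simp add: LIMSEQ_const_iff uniform_limit_const)

lemma sint_add:
  assumes mu: "\<mu> \<in> cabv" and f: "unif_simple f" and g: "unif_simple g"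
  shows "sint ip (\<lambda>t. f t + g t) \<mu> = sint ip f \<mu> + sint ip g \<mu>"
proof -
  obtain s u where s: "\<And>m::nat. simple_function borel (s m)" "uniform_limit UNIV s f sequentially"
    and u: "\<And>m::nat. simple_function borel (u m)" "uniform_limit UNIV u g sequentially"
    using f g unfolding unif_simple_def by blast
  have "(\<lambda>m. simple_sint ip (\<lambda>t. s m t + u m t) \<mu>) \<longlonglongrightarrow> sint ip (\<lambda>t. f t + g t) \<mu>"
    by (rule simple_sint_tendsto_sint[OF mu simple_function_add[OF s(1) u(1)] uniform_limit_add[OF s(2) u(2)]])
  moreover have "(\<lambda>m. simple_sint ip (\<lambda>t. s m t + u m t) \<mu>) \<longlonglongrightarrow> sint ip f \<mu> + sint ip g \<mu>"
    unfolding simple_sint_add[OF mu s(1) u(1)]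
    by (rule tendsto_add[OF simple_sint_tendsto_sint[OF mu s] simple_sint_tendsto_sint[OF mu u]])
  ultimately show ?thesis by (rule LIMSEQ_unique)
qed

lemma sint_scaleR:
  assumes mu: "\<mu> \<in> cabv" and f: "unif_simple f"
  shows "sint ip (\<lambda>t. r *\<^sub>R f t) \<mu> = r *\<^sub>R sint ip f \<mu>"
proof -
  obtain s where s: "\<And>m::nat. simple_function borel (s m)" "uniform_limit UNIV s f sequentially"
    using f unfolding unif_simple_def by blast
  have "(\<lambda>m. simple_sint ip (\<lambda>t. r *\<^sub>R s m t) \<mu>) \<longlonglongrightarrow> sint ip (\<lambda>t. r *\<^sub>R f t) \<mu>"
    by (rule simple_sint_tendsto_sint[OF mu simple_function_compose1[OF s(1), of "\<lambda>x. r *\<^sub>R x"]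
          bounded_linear.uniform_limit[OF bounded_linear_scaleR_right s(2)]])
  moreover have "(\<lambda>m. simple_sint ip (\<lambda>t. r *\<^sub>R s m t) \<mu>) \<longlonglongrightarrow> r *\<^sub>R sint ip f \<mu>"
    unfolding simple_sint_scaleR[OF mu s(1)]
    by (rule tendsto_scaleR[OF tendsto_const simple_sint_tendsto_sint[OF mu s]])
  ultimately show ?thesis by (rule LIMSEQ_unique)
qed

lemma sint_diff:
  assumes mu: "\<mu> \<in> cabv" and f: "unif_simple f" and g: "unif_simple g"
  shows "sint ip (\<lambda>t. f t - g t) \<mu> = sint ip f \<mu> - sint ip g \<mu>"
  using sint_add[OF mu f unif_simple_scaleR[OF g], of "-1"] sint_scaleR[OF mu g, of "-1"] by simp

lemma cmod_sint_le_integral: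
  assumes mu: "\<mu> \<in> cabv" and f: "unif_simple f"
  shows "cmod (sint ip f \<mu>) \<le> (\<integral>t. norm (f t) \<partial>tv_measure \<mu>)"
proof -
  interpret finite_measure "tv_measure \<mu>" by (rule finite_measure_tv_measure[OF mu])
  obtain s where s: "\<And>m::nat. simple_function borel (s m)" "uniform_limit UNIV s f sequentially"
    using f unfolding unif_simple_def by blast
  let ?V = "measure (tv_measure \<mu>) UNIV"
  have "cmod (sint ip f \<mu>) \<le> (\<integral>t. norm (f t) \<partial>tv_measure \<mu>) + e * ?V" if e: "0 < e" for e
  proof -
    have "\<forall>\<^sub>F m in sequentially. cmod (simple_sint ip (s m) \<mu>) \<le> (\<integral>t. norm (f t) \<partial>tv_measure \<mu>) + e * ?V"
      using uniform_limitD[OF s(2) e]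
    proof eventually_elim
      case (elim m)
      have "norm (s m t) \<le> norm (f t) + e" for t
      proof -
        have "norm (s m t) \<le> norm (f t) + dist (s m t) (f t)"
          by (metis dist_norm norm_triangle_sub)
        then show ?thesis using elim[rule_format, of t] by simp
      qed
      then have "(\<integral>t. norm (s m t) \<partial>tv_measure \<mu>) \<le> (\<integral>t. norm (f t) + e \<partial>tv_measure \<mu>)"
        using s f by (intro integral_mono Bochner_Integration.integrable_add unif_simple_norm_integrable[OF mu])
          (auto intro: unif_simple_simple)
      also have "\<dots> = (\<integral>t. norm (f t) \<partial>tv_measure \<mu>) + e * ?V"
        using unif_simple_norm_integrable[OF mu f] by simp
      finally show ?case using cmod_simple_sint_le_integral[OF mu s(1), of m] by simp
    qed
    then show ?thesis
      using tendsto_norm[OF simple_sint_tendsto_sint[OF mu s]] by (intro tendsto_upperbound) auto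
  qed
  note le = this
  have V: "0 \<le> ?V" by simp
  show ?thesis
  proof (rule field_le_epsilon)
    fix e :: real assume e: "0 < e"
    have "e / (v + 1) * v \<le> e" if "0 \<le> v" for v :: real
      using e that by (simp add: field_simps)
    note this[OF V]
    moreover have "0 < e / (?V + 1)" using e V by (intro divide_pos_pos) linarith+
    ultimately show "cmod (sint ip f \<mu>) \<le> (\<integral>t. norm (f t) \<partial>tv_measure \<mu>) + e"
      using le[of "e / (?V + 1)"] by linarith
  qed
qed

lemma cmod_sint_le:
  assumes mu: "\<mu> \<in> cabv" and f: "unif_simple f" and C: "\<And>t. norm (f t) \<le> C"
  shows "cmod (sint ip f \<mu>) \<le> C * measure (tv_measure \<mu>) UNIV"
proof -
  interpret finite_measure "tv_measure \<mu>" by (rule finite_measure_tv_measure[OF mu])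
  have "(\<integral>t. norm (f t) \<partial>tv_measure \<mu>) \<le> (\<integral>t. C \<partial>tv_measure \<mu>)"
    using C by (intro integral_mono unif_simple_norm_integrable[OF mu] f) auto
  then show ?thesis using cmod_sint_le_integral[OF mu f] by (simp add: mult.commute)
qed

lemma sint_const: "\<mu> \<in> cabv \<Longrightarrow> sint ip (\<lambda>_. x) \<mu> = ip x (\<mu> UNIV)"
  by (simp add: sint_simple simple_sint_def)

text \<open>
  As integrals are dominated by the total variation measure, the dominated convergence theorem
  applies to the differences from the indicator function.
\<close>

lemma sint_tendsto_indicator:
  fixes h :: "nat \<Rightarrow> 't::topological_space \<Rightarrow> real"
  assumes mu: "\<mu> \<in> cabv" and h: "\<And>n. unif_simple (\<lambda>t. h n t *\<^sub>R x)" and B: "B \<in> sets borel"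
    and meas: "\<And>n. h n \<in> borel_measurable borel"
    and h01: "\<And>n t. 0 \<le> h n t \<and> h n t \<le> 1" and lim: "\<And>t. (\<lambda>n. h n t) \<longlonglongrightarrow> indicator B t"
  shows "(\<lambda>n. sint ip (\<lambda>t. h n t *\<^sub>R x) \<mu>) \<longlonglongrightarrow> ip x (\<mu> B)"
proof -
  interpret finite_measure "tv_measure \<mu>" by (rule finite_measure_tv_measure[OF mu])
  have sB: "simple_function borel (indicator B :: 't \<Rightarrow> real)"
    using B by (intro simple_function_indicator) auto
  then have sBx: "simple_function borel (\<lambda>t. indicator B t *\<^sub>R x)" by (rule simple_function_compose1)
  have range: "range (indicator B :: 't \<Rightarrow> real) \<subseteq> {0, 1}" by (auto simp: indicator_def)
  have "(indicator B :: 't \<Rightarrow> real) -` {1} = B" by (auto simp: indicator_def)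
  then have "sint ip (\<lambda>t. indicator B t *\<^sub>R x) \<mu> = ip x (\<mu> B)"
    using simple_sint_compose[OF mu sB _ range, of "\<lambda>r. r *\<^sub>R x"]
    by (simp add: sint_simple[OF mu sBx])
  moreover have "(\<lambda>n. sint ip (\<lambda>t. h n t *\<^sub>R x) \<mu> - sint ip (\<lambda>t. indicator B t *\<^sub>R x) \<mu>) \<longlonglongrightarrow> 0"
  proof (rule Lim_null_comparison)
    show "\<forall>\<^sub>F n in sequentially.
        norm (sint ip (\<lambda>t. h n t *\<^sub>R x) \<mu> - sint ip (\<lambda>t. indicator B t *\<^sub>R x) \<mu>)
        \<le> (\<integral>t. \<bar>h n t - indicator B t\<bar> * norm x \<partial>tv_measure \<mu>)"
    proof (intro always_eventually allI)
      fix n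
      show "norm (sint ip (\<lambda>t. h n t *\<^sub>R x) \<mu> - sint ip (\<lambda>t. indicator B t *\<^sub>R x) \<mu>)
        \<le> (\<integral>t. \<bar>h n t - indicator B t\<bar> * norm x \<partial>tv_measure \<mu>)"
        using cmod_sint_le_integral[OF mu unif_simple_diff[OF h unif_simple_simple[OF sBx]]]
        by (simp add: sint_diff[OF mu h unif_simple_simple[OF sBx], symmetric] scaleR_left_diff_distrib[symmetric])
    qed
    have "(\<lambda>n. \<integral>t. \<bar>h n t - indicator B t\<bar> * norm x \<partial>tv_measure \<mu>)
        \<longlonglongrightarrow> (\<integral>t. 0 \<partial>tv_measure \<mu>)"
    proof (rule integral_dominated_convergence[where w = "\<lambda>_. norm x"])
      show "(\<lambda>t. \<bar>h n t - indicator B t\<bar> * norm x) \<in> borel_measurable (tv_measure \<mu>)" for n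
        using meas[of n] B by measurable
      show "AE t in tv_measure \<mu>. (\<lambda>n. \<bar>h n t - indicator B t\<bar> * norm x) \<longlonglongrightarrow> 0"
        using lim by (auto intro!: tendsto_mult_left_zero tendsto_rabs_zero simp: LIM_zero_iff)
      have "\<bar>h n t - indicator B t\<bar> \<le> 1" for n t
        using h01[of n t] by (auto simp: indicator_def)
      then have "\<bar>h n t - indicator B t\<bar> * norm x \<le> norm x" for n t
        using mult_right_mono[of _ 1 "norm x"] by simp
      then show "AE t in tv_measure \<mu>. norm (\<bar>h n t - indicator B t\<bar> * norm x) \<le> norm x" for n
        by (intro always_eventually allI) (simp add: abs_mult)
    qed auto
    then show "(\<lambda>n. \<integral>t. \<bar>h n t - indicator B t\<bar> * norm x \<partial>tv_measure \<mu>) \<longlonglongrightarrow> 0" by simp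
  qed
  ultimately show ?thesis by (simp add: LIM_zero_iff)
qed

end

section \<open>Continuous functions on a compact metric space\<close>

text \<open>
  Maps with finitely many values close to the identity play the role of tagged partitions:
  \<open>simple_sint ip (f \<circ> q) \<mu>\<close> is a Riemann sum of \<open>f\<close>.
\<close>

lemma compact_simple_near_identity:
  assumes "compact (UNIV :: 't::metric_space set)" and "0 < e"
  shows "\<exists>q :: 't \<Rightarrow> 't. simple_function borel q \<and> (\<forall>t. dist (q t) t < e)"
proof -
  have near: "\<exists>q :: 't \<Rightarrow> 't. simple_function borel q \<and> (\<forall>t\<in>(\<Union>x\<in>F. ball x e). dist (q t) t < e)"
    if "finite F" for F :: "'t set"
    using that
  proof (induction F rule: finite_induct)
    case empty
    have "simple_function (borel :: 't measure) (\<lambda>_. undefined :: 't)" by simp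
    then show ?case by blast
  next
    case (insert x F)
    then obtain q :: "'t \<Rightarrow> 't" where q: "simple_function borel q"
      "\<forall>t\<in>(\<Union>x\<in>F. ball x e). dist (q t) t < e" by blast
    have "simple_function borel (\<lambda>t. if t \<in> ball x e then x else q t)"
      using q(1) by (intro simple_function_If_set) auto
    moreover have "\<forall>t\<in>(\<Union>x\<in>insert x F. ball x e). dist (if t \<in> ball x e then x else q t) t < e"
      using q(2) by auto
    ultimately show ?case by blast
  qed
  have cover: "UNIV \<subseteq> (\<Union>x\<in>(UNIV :: 't set). ball x e)" using assms(2) by auto
  obtain F :: "'t set" where F: "finite F" "UNIV \<subseteq> (\<Union>x\<in>F. ball x e)"
    by (rule compactE_image[OF assms(1) _ cover]) auto
  obtain q :: "'t \<Rightarrow> 't" where q: "simple_function borel q" "\<forall>t\<in>(\<Union>x\<in>F. ball x e). dist (q t) t < e"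
    using near[OF F(1)] by blast
  then have "\<forall>t. dist (q t) t < e" using F(2) by (meson UNIV_I subsetD)
  with q(1) show ?thesis by blast
qed

lemma compact_simple_tendsto_identity:
  assumes "compact (UNIV :: 't::metric_space set)"
  obtains q :: "nat \<Rightarrow> 't::metric_space \<Rightarrow> 't"
  where "\<And>n. simple_function borel (q n)" "\<And>n t. dist (q n t) t < inverse (real (Suc n))"
proof -
  have "\<exists>q :: 't \<Rightarrow> 't. simple_function borel q \<and> (\<forall>t. dist (q t) t < inverse (real (Suc n)))" for n
    by (rule compact_simple_near_identity[OF assms]) simp
  then show ?thesis using that by metis
qed

lemma uniform_limit_compose_near_identity:
  fixes f :: "'t::metric_space \<Rightarrow> 'x::metric_space"
  assumes "compact (UNIV :: 't set)" "continuous_on UNIV f"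
    and q: "\<And>n t. dist (q n t) t < inverse (real (Suc n))"
  shows "uniform_limit UNIV (\<lambda>n t. f (q n t)) f sequentially"
proof (rule uniform_limitI)
  fix e :: real assume "0 < e"
  have "uniformly_continuous_on UNIV f" by (rule compact_uniformly_continuous[OF assms(2,1)])
  then obtain d where d: "0 < d" "\<And>s t. dist s t < d \<Longrightarrow> dist (f s) (f t) < e"
    using \<open>0 < e\<close> unfolding uniformly_continuous_on_def by (metis UNIV_I dist_commute)
  obtain N where N: "inverse (real (Suc N)) < d" using reals_Archimedean[OF d(1)] by auto
  have "dist (f (q n t)) (f t) < e" if "N \<le> n" for n t
  proof (rule d(2))
    have "inverse (real (Suc n)) \<le> inverse (real (Suc N))" using that by (simp add: le_imp_inverse_le)
    then show "dist (q n t) t < d" using q[of n t] N by linarith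
  qed
  then show "\<forall>\<^sub>F n in sequentially. \<forall>t\<in>UNIV. dist (f (q n t)) (f t) < e"
    by (auto simp: eventually_sequentially)
qed

lemma unif_simple_continuous:
  fixes f :: "'t::metric_space \<Rightarrow> 'x::real_normed_vector"
  assumes "compact (UNIV :: 't set)" "continuous_on UNIV f"
  shows "unif_simple f"
proof -
  obtain q :: "nat \<Rightarrow> 't \<Rightarrow> 't" where q: "\<And>n. simple_function borel (q n)"
    "\<And>n t. dist (q n t) t < inverse (real (Suc n))"
    using compact_simple_tendsto_identity[OF assms(1)] by blast
  have "simple_function borel (\<lambda>t. f (q n t))" for n
    by (rule simple_function_compose1[OF q(1)])
  then show ?thesis
    using uniform_limit_compose_near_identity[OF assms q(2)]
    unfolding unif_simple_def by (intro exI[of _ "\<lambda>n t. f (q n t)"]) auto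
qed

lemma apply_Bcontfun_compact:
  fixes f :: "'t::metric_space \<Rightarrow> 'x::metric_space"
  assumes "compact (UNIV :: 't set)" "continuous_on UNIV f"
  shows "apply_bcontfun (Bcontfun f) = f"
  using assms by (intro Bcontfun_inverse) (auto simp: bcontfun_def intro: compact_imp_bounded compact_continuous_image)

lemma closed_indicator_limit:
  fixes F :: "'t::metric_space set"
  assumes "closed F"
  obtains h :: "nat \<Rightarrow> 't \<Rightarrow> real" where "\<And>n. continuous_on UNIV (h n)"
    "\<And>n t. 0 \<le> h n t \<and> h n t \<le> 1" "\<And>t. (\<lambda>n. h n t) \<longlonglongrightarrow> indicator F t"
proof (cases "F = {}")
  case True
  then show ?thesis by (intro that[of "\<lambda>_ _. 0"]) auto
next
  case False
  define h where "h n t = max 0 (1 - real n * infdist t F)" for n t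
  have "continuous_on UNIV (h n)" for n
    unfolding h_def by (intro continuous_intros)
  moreover have "0 \<le> h n t \<and> h n t \<le> 1" for n t
    unfolding h_def by (simp add: infdist_nonneg)
  moreover have "(\<lambda>n. h n t) \<longlonglongrightarrow> indicator F t" for t
  proof (cases "t \<in> F")
    case True
    then show ?thesis by (simp add: h_def)
  next
    case False
    then have pos: "0 < infdist t F"
      using infdist_pos_not_in_closed[OF assms \<open>F \<noteq> {}\<close>] by blast
    then obtain N where N: "1 < real N * infdist t F" using reals_Archimedean3 by blast
    have "h n t = 0" if "N \<le> n" for n
    proof -
      have "real N * infdist t F \<le> real n * infdist t F"
        using that pos by (intro mult_right_mono) auto
      then show ?thesis unfolding h_def using N by simp
    qed
    then have "(\<lambda>n. h n t) \<longlonglongrightarrow> 0"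
      by (intro tendsto_eventually) (auto simp: eventually_sequentially)
    then show ?thesis using False by simp
  qed
  ultimately show ?thesis by (rule that)
qed

lemma borel_induct_closed [consumes 1, case_names closed compl union]:
  assumes A: "A \<in> sets (borel :: 't::topological_space measure)"
    and closed: "\<And>F. closed F \<Longrightarrow> P F"
    and compl: "\<And>A. A \<in> sets borel \<Longrightarrow> P A \<Longrightarrow> P (- A)"
    and union: "\<And>A. range A \<subseteq> sets borel \<Longrightarrow> disjoint_family A \<Longrightarrow> (\<And>i::nat. P (A i)) \<Longrightarrow> P (\<Union>i. A i)"
  shows "P A"
proof -
  have sets: "sigma_sets UNIV (Collect closed) = sets (borel :: 't measure)"
    by (simp add: borel_eq_closed)
  have "Int_stable (Collect (closed :: 't set \<Rightarrow> bool))" "Collect (closed :: 't set \<Rightarrow> bool) \<subseteq> Pow UNIV"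
    "A \<in> sigma_sets UNIV (Collect closed)"
    using A by (auto simp: Int_stable_def sets)
  then show ?thesis
  proof (induct A rule: sigma_sets_induct_disjoint)
    case (compl A)
    then show ?case using assms(3)[of A] by (simp add: sets Compl_eq_Diff_UNIV)
  next
    case (union A)
    then show ?case by (intro assms(4)) (auto simp: sets)
  qed (use closed in auto)
qed

context hilbert_space_over
begin

lemma cabv_eqI:
  assumes mu: "\<mu> \<in> cabv" and nu: "\<nu> \<in> cabv"
    and "\<And>A x. A \<in> sets borel \<Longrightarrow> ip x (\<mu> A) = ip x (\<nu> A)"
  shows "\<mu> = \<nu>"
proof
  fix A show "\<mu> A = \<nu> A"
    using assms cabv_outside[OF mu, of A] cabv_outside[OF nu, of A] by (cases "A \<in> sets borel") (auto intro: ip_ext)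
qed

text \<open>
  A measure is determined by its integrals of continuous functions: on closed sets by dominated
  convergence, hence on all Borel sets.
\<close>

lemma inj_on_Phi:
  assumes T: "compact (UNIV :: 't::metric_space set)"
  shows "inj_on (Phi ip :: ('t set \<Rightarrow> 'x) \<Rightarrow> _) cabv"
proof (rule inj_onI)
  fix \<mu> \<nu> :: "'t set \<Rightarrow> 'x"
  assume mu: "\<mu> \<in> cabv" and nu: "\<nu> \<in> cabv" and eq: "Phi ip \<mu> = Phi ip \<nu>"
  have sint_eq: "sint ip f \<mu> = sint ip f \<nu>" if "continuous_on UNIV f" for f
    using fun_cong[OF eq, of "Bcontfun f"] that by (simp add: Phi_def apply_Bcontfun_compact[OF T])
  show "\<mu> = \<nu>"
  proof (rule cabv_eqI[OF mu nu])
    fix A :: "'t set" and x assume "A \<in> sets borel"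
    then show "ip x (\<mu> A) = ip x (\<nu> A)"
    proof (induction A rule: borel_induct_closed)
      case (closed F)
      obtain h :: "nat \<Rightarrow> 't \<Rightarrow> real" where h: "\<And>n. continuous_on UNIV (h n)"
        "\<And>n t. 0 \<le> h n t \<and> h n t \<le> 1" "\<And>t. (\<lambda>n. h n t) \<longlonglongrightarrow> indicator F t"
        using closed_indicator_limit[OF closed] by blast
      have cont: "continuous_on UNIV (\<lambda>t. h n t *\<^sub>R x)" for n by (intro continuous_intros h)
      have F: "F \<in> sets borel" using closed by simp
      have "(\<lambda>n. sint ip (\<lambda>t. h n t *\<^sub>R x) \<mu>) \<longlonglongrightarrow> ip x (\<mu> F)"
        by (rule sint_tendsto_indicator[OF mu unif_simple_continuous[OF T cont] F
              borel_measurable_continuous_onI[OF h(1)] h(2,3)])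
      moreover have "(\<lambda>n. sint ip (\<lambda>t. h n t *\<^sub>R x) \<nu>) \<longlonglongrightarrow> ip x (\<nu> F)"
        by (rule sint_tendsto_indicator[OF nu unif_simple_continuous[OF T cont] F
              borel_measurable_continuous_onI[OF h(1)] h(2,3)])
      ultimately show ?case unfolding sint_eq[OF cont] by (rule LIMSEQ_unique)
    next
      case (compl A)
      have "ip x (\<mu> UNIV) = ip x (\<nu> UNIV)"
        using sint_eq[of "\<lambda>_. x"] by (simp add: sint_const mu nu)
      then show ?case
        using compl by (simp add: cabv_Compl[OF mu] cabv_Compl[OF nu] ip.diff_right)
    next
      case (union A)
      have "(\<lambda>i. ip x (\<mu> (A i))) sums ip x (\<mu> (\<Union>i. A i))"
        by (rule bounded_linear.sums[OF ip.bounded_linear_right cabv_sums[OF mu union(1,2)]])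
      moreover have "(\<lambda>i. ip x (\<nu> (A i))) sums ip x (\<nu> (\<Union>i. A i))"
        by (rule bounded_linear.sums[OF ip.bounded_linear_right cabv_sums[OF nu union(1,2)]])
      ultimately show ?case using union(3) sums_unique2 by simp
    qed
  qed
qed

end

section \<open>Lipschitz constants\<close>

lemma lip_const_bdd:
  assumes "C-lipschitz_on UNIV f"
  shows "bdd_above ((\<lambda>(s, t). dist (f s) (f t) / dist s t) ` {(s, t). s \<noteq> t})"
  using lipschitz_onD[OF assms] by (intro bdd_aboveI[of _ C]) (auto simp: divide_le_eq)

lemma dist_le_lip_const:
  assumes "C-lipschitz_on UNIV f"
  shows "dist (f s) (f t) \<le> lip_const f * dist s t"
proof (cases "s = t")
  case False
  have "dist (f s) (f t) / dist s t \<le> lip_const f"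
    unfolding lip_const_def using False cSUP_upper[OF _ lip_const_bdd[OF assms], of "(s, t)"] by simp
  then show ?thesis using False by (simp add: divide_le_eq)
qed simp

lemma lip_const_le:
  assumes "C-lipschitz_on UNIV f" "\<exists>s t :: 'a::metric_space. s \<noteq> t"
  shows "lip_const (f :: 'a \<Rightarrow> _) \<le> C"
  unfolding lip_const_def using assms(2) lipschitz_onD[OF assms(1)]
  by (intro cSUP_least) (auto simp: divide_le_eq)

lemma lip_const_nonneg:
  assumes "C-lipschitz_on UNIV f" "\<exists>s t :: 'a::metric_space. s \<noteq> t"
  shows "0 \<le> lip_const (f :: 'a \<Rightarrow> _)"
proof -
  obtain s t :: 'a where "s \<noteq> t" using assms(2) by blast
  then have "0 \<le> lip_const f * dist s t" "0 < dist s t"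
    using order_trans[OF zero_le_dist dist_le_lip_const[OF assms(1)]] by auto
  then show ?thesis by (simp add: zero_le_mult_iff)
qed


section \<open>Weak estimates for the Bochner integral\<close>

context hilbert_space_over
begin

lemma has_bochner_unique:
  fixes z :: 'x
  assumes "has_bochner M f z" "has_bochner M f z'" shows "z = z'"
proof (rule ip_ext)
  fix x
  have "ip z x = ip z' x"
    using has_bochner_ip[OF assms(1)] has_bochner_ip[OF assms(2)] by (rule has_bochner_integral_eq)
  then show "ip x z = ip x z'" by (metis ip_commute)
qed

lemma bochner_integrable_ip:
  assumes "bochner_integrable M f"
  shows "has_bochner_integral M (\<lambda>a. ip (f a) y) (ip (bochner_integral M f) y)"
proof -
  obtain z where z: "has_bochner M f z" using assms unfolding bochner_integrable_def by blast
  then have "bochner_integral M f = z"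
    unfolding bochner_integral_def using has_bochner_unique by blast
  then show ?thesis using has_bochner_ip[OF z] by simp
qed

text \<open>
  A weak integral \<open>z\<close> of \<open>g\<close> obeys the triangle inequality: testing it against \<open>z\<close> itself gives
  \<open>(norm z)\<^sup>2\<close> on one side and a factor \<open>norm z\<close> on the other.
\<close>

lemma weak_integral_norm_le:
  assumes int: "has_bochner_integral M (\<lambda>a. ip (g a) z) (ip z z)"
    and w: "integrable M w" and le: "\<And>a. a \<in> space M \<Longrightarrow> norm (g a) \<le> w a"
  shows "norm z \<le> integral\<^sup>L M w"
proof (cases "z = 0")
  case True
  have "0 \<le> w a" if "a \<in> space M" for a using le[OF that] norm_ge_zero order_trans by blast
  then show ?thesis using True by simp
next
  case False
  have "(norm z)\<^sup>2 = cmod (ip z z)" by (simp add: ip_self norm_power)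
  also have "ip z z = (\<integral>a. ip (g a) z \<partial>M)" using int by (simp add: has_bochner_integral_integral_eq)
  also have "cmod \<dots> \<le> (\<integral>a. cmod (ip (g a) z) \<partial>M)" by (rule integral_norm_bound)
  also have "\<dots> \<le> (\<integral>a. w a * norm z \<partial>M)"
  proof (rule integral_mono)
    show "integrable M (\<lambda>a. cmod (ip (g a) z))" using int by (simp add: has_bochner_integral_iff)
    show "cmod (ip (g a) z) \<le> w a * norm z" if "a \<in> space M" for a
      using cmod_ip_le[of "g a" z] mult_right_mono[OF le[OF that], of "norm z"] by simp
  qed (use w in simp)
  also have "\<dots> = integral\<^sup>L M w * norm z" by simp
  finally show ?thesis using False by (simp add: power2_eq_square)
qed

end

section \<open>The averaging operator on continuous functions\<close>

locale random_operators = hilbert_space_over K sc ip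
  for K :: "complex set" and sc :: "complex \<Rightarrow> 'x::banach \<Rightarrow> 'x" and ip :: "'x \<Rightarrow> 'x \<Rightarrow> complex" +
  fixes W :: "'th measure"
    and \<omega> :: "'t::metric_space \<Rightarrow> 'th \<Rightarrow> 't"
    and R :: "'x \<Rightarrow> 'th \<Rightarrow> 'x"
  assumes T_compact: "compact (UNIV :: 't set)"
    and T_two_elements: "\<exists>s t::'t. s \<noteq> t"
    and \<omega>_measurable: "(\<lambda>(t, \<theta>). \<omega> t \<theta>) \<in> measurable (borel \<Otimes>\<^sub>M W) borel"
    and R_linear: "\<And>\<theta>. \<theta> \<in> space W \<Longrightarrow> cont_linear_over K sc (\<lambda>x. R x \<theta>)"
    and \<omega>_lipschitz: "\<And>\<theta>. \<theta> \<in> space W \<Longrightarrow> \<exists>C. C-lipschitz_on UNIV (\<lambda>t. \<omega> t \<theta>)"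
    and norm_R_measurable: "(\<lambda>\<theta>. onorm (\<lambda>x. R x \<theta>)) \<in> borel_measurable W"
    and norm_R_integrable:
      "integrable W (\<lambda>\<theta>. onorm (\<lambda>x. R x \<theta>) * (1 + lip_const (\<lambda>t. \<omega> t \<theta>)))"
    and HC_integrable:
      "\<And>(f :: 't \<Rightarrow>\<^sub>C 'x) t. bochner_integrable W (\<lambda>\<theta>. R (apply_bcontfun f (\<omega> t \<theta>)) \<theta>)"
begin

abbreviation nR :: "'th \<Rightarrow> real" where "nR \<theta> \<equiv> onorm (\<lambda>x. R x \<theta>)"
abbreviation r :: "'th \<Rightarrow> real" where "r \<theta> \<equiv> lip_const (\<lambda>t. \<omega> t \<theta>)"

lemma bounded_linear_R: "\<theta> \<in> space W \<Longrightarrow> bounded_linear (\<lambda>x. R x \<theta>)"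
  using R_linear by (simp add: cont_linear_over_def)

lemma R_sc: "\<theta> \<in> space W \<Longrightarrow> c \<in> K \<Longrightarrow> R (sc c x) \<theta> = sc c (R x \<theta>)"
  using R_linear by (simp add: cont_linear_over_def)

lemma nR_nonneg: "\<theta> \<in> space W \<Longrightarrow> 0 \<le> nR \<theta>"
  by (rule onorm_pos_le[OF bounded_linear_R])

lemma norm_R_le: "\<theta> \<in> space W \<Longrightarrow> norm (R x \<theta>) \<le> nR \<theta> * norm x"
  by (rule onorm[OF bounded_linear_R])

lemma norm_R_le_bound: "\<theta> \<in> space W \<Longrightarrow> norm x \<le> C \<Longrightarrow> norm (R x \<theta>) \<le> nR \<theta> * C"
  using norm_R_le mult_left_mono[OF _ nR_nonneg] order_trans by meson

lemma r_nonneg: "\<theta> \<in> space W \<Longrightarrow> 0 \<le> r \<theta>"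
  using \<omega>_lipschitz lip_const_nonneg[OF _ T_two_elements] by blast

lemma dist_\<omega>_le: "\<theta> \<in> space W \<Longrightarrow> dist (\<omega> s \<theta>) (\<omega> t \<theta>) \<le> r \<theta> * dist s t"
  using \<omega>_lipschitz dist_le_lip_const by blast

lemma continuous_\<omega>: "\<theta> \<in> space W \<Longrightarrow> continuous_on A (\<lambda>t. \<omega> t \<theta>)"
  using \<omega>_lipschitz lipschitz_on_continuous_on continuous_on_subset by blast

lemma vimage_\<omega>_borel: "\<theta> \<in> space W \<Longrightarrow> A \<in> sets borel \<Longrightarrow> (\<lambda>t. \<omega> t \<theta>) -` A \<in> sets borel"
  using measurable_sets[OF borel_measurable_continuous_onI[OF continuous_\<omega>], of \<theta> A] by simp

lemma continuous_R_compose: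
  assumes "\<theta> \<in> space W" "continuous_on UNIV f"
  shows "continuous_on UNIV (\<lambda>t. R (f (\<omega> t \<theta>)) \<theta>)"
  by (rule bounded_linear.continuous_on[OF bounded_linear_R[OF assms(1)]
        continuous_on_compose2[OF assms(2) continuous_\<omega>[OF assms(1)]]]) simp

lemma integrable_nR: "integrable W nR"
proof (rule Bochner_Integration.integrable_bound[OF norm_R_integrable norm_R_measurable])
  have "norm (nR \<theta>) \<le> norm (nR \<theta> * (1 + r \<theta>))" if "\<theta> \<in> space W" for \<theta>
    using nR_nonneg[OF that] r_nonneg[OF that] by (simp add: abs_mult algebra_simps)
  then show "AE \<theta> in W. norm (nR \<theta>) \<le> norm (nR \<theta> * (1 + r \<theta>))" by (rule AE_I2)
qed

lemma integrable_nR_r: "integrable W (\<lambda>\<theta>. nR \<theta> * r \<theta>)"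
  using Bochner_Integration.integrable_diff[OF norm_R_integrable integrable_nR] by (simp add: algebra_simps)

text \<open>
  The operator \<open>HC\<close> on plain functions, which spares the conversion of Lipschitz functions to the type
  of bounded continuous functions.
\<close>

definition HCf :: "('t \<Rightarrow> 'x) \<Rightarrow> 't \<Rightarrow> 'x" where
  "HCf f t = bochner_integral W (\<lambda>\<theta>. R (f (\<omega> t \<theta>)) \<theta>)"

lemma HCf_ip:
  assumes "continuous_on UNIV f"
  shows "has_bochner_integral W (\<lambda>\<theta>. ip (R (f (\<omega> t \<theta>)) \<theta>) y) (ip (HCf f t) y)"
  using bochner_integrable_ip[OF HC_integrable[of "Bcontfun f" t]]
  by (simp add: HCf_def apply_Bcontfun_compact[OF T_compact assms])

lemma ip_R_measurable: "(\<lambda>\<theta>. ip (R x \<theta>) y) \<in> borel_measurable W"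
  using HCf_ip[of "\<lambda>_. x" undefined y] by (auto simp: has_bochner_integral_iff)

lemma continuous_bounded: "continuous_on UNIV f \<Longrightarrow> \<exists>C. \<forall>t::'t. norm (f t :: 'x) \<le> C"
  using unif_simple_bounded unif_simple_continuous[OF T_compact] by blast

lemma HCf_diff_ip:
  assumes "continuous_on UNIV f"
  shows "has_bochner_integral W (\<lambda>\<theta>. ip (R (f (\<omega> s \<theta>)) \<theta> - R (f (\<omega> t \<theta>)) \<theta>) y)
    (ip (HCf f s - HCf f t) y)"
  using has_bochner_integral_diff[OF HCf_ip[OF assms] HCf_ip[OF assms]] by (simp add: ip.diff_left)

lemma norm_R_diff_le:
  "\<theta> \<in> space W \<Longrightarrow> norm (R x \<theta> - R y \<theta>) \<le> nR \<theta> * norm (x - y)"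
  using norm_R_le[of \<theta> "x - y"] linear_diff[OF bounded_linear.linear[OF bounded_linear_R[of \<theta>]]] by simp

text \<open>
  Testing \<open>HCf f (s n) - HCf f t\<close> against itself turns its squared norm into an integral of
  scalar functions, to which dominated convergence applies.
\<close>

lemma continuous_HCf:
  assumes f: "continuous_on UNIV f" shows "continuous_on UNIV (HCf f)"
proof (rule continuous_on_sequentiallyI)
  fix s :: "nat \<Rightarrow> 't" and t assume s: "s \<longlonglongrightarrow> t"
  obtain C where C: "\<And>t. norm (f t) \<le> C" using continuous_bounded[OF f] by blast
  have C0: "0 \<le> C" using C norm_ge_zero order_trans by blast
  define y where "y n = HCf f (s n) - HCf f t" for n
  let ?g = "\<lambda>n \<theta>. R (f (\<omega> (s n) \<theta>)) \<theta> - R (f (\<omega> t \<theta>)) \<theta>"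
  have int: "has_bochner_integral W (\<lambda>\<theta>. ip (?g n \<theta>) (y n)) (ip (y n) (y n))" for n
    unfolding y_def by (rule HCf_diff_ip[OF f])
  have g_le: "norm (?g n \<theta>) \<le> nR \<theta> * (2 * C)" if "\<theta> \<in> space W" for n \<theta>
    using norm_triangle_ineq4[of "R (f (\<omega> (s n) \<theta>)) \<theta>" "R (f (\<omega> t \<theta>)) \<theta>"]
      norm_R_le_bound[OF that C, of "\<omega> (s n) \<theta>"] norm_R_le_bound[OF that C, of "\<omega> t \<theta>"] by linarith
  define D where "D = (\<integral>\<theta>. nR \<theta> * (2 * C) \<partial>W)"
  have y_le: "norm (y n) \<le> D" for n
    unfolding D_def by (rule weak_integral_norm_le[OF int _ g_le]) (simp add: integrable_nR)
  then have D0: "0 \<le> D" using norm_ge_zero order_trans by blast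
  have "(\<lambda>n. \<integral>\<theta>. ip (?g n \<theta>) (y n) \<partial>W) \<longlonglongrightarrow> (\<integral>\<theta>. 0 \<partial>W)"
  proof (rule integral_dominated_convergence[where w = "\<lambda>\<theta>. nR \<theta> * (2 * C) * D"])
    show "(\<lambda>\<theta>. ip (?g n \<theta>) (y n)) \<in> borel_measurable W" for n
      using int[of n] by (auto simp: has_bochner_integral_iff)
    show "integrable W (\<lambda>\<theta>. nR \<theta> * (2 * C) * D)" by (simp add: integrable_nR)
    show "AE \<theta> in W. norm (ip (?g n \<theta>) (y n)) \<le> nR \<theta> * (2 * C) * D" for n
    proof (intro AE_I2)
      fix \<theta> assume th: "\<theta> \<in> space W"
      have "norm (?g n \<theta>) * norm (y n) \<le> nR \<theta> * (2 * C) * D"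
        using nR_nonneg[OF th] C0 by (intro mult_mono g_le[OF th] y_le) auto
      then show "norm (ip (?g n \<theta>) (y n)) \<le> nR \<theta> * (2 * C) * D"
        using cmod_ip_le[of "?g n \<theta>" "y n"] by linarith
    qed
    show "AE \<theta> in W. (\<lambda>n. ip (?g n \<theta>) (y n)) \<longlonglongrightarrow> 0"
    proof (intro AE_I2)
      fix \<theta> assume th: "\<theta> \<in> space W"
      have "(\<lambda>n. R (f (\<omega> (s n) \<theta>)) \<theta>) \<longlonglongrightarrow> R (f (\<omega> t \<theta>)) \<theta>"
        using continuous_on_tendsto_compose[OF continuous_R_compose[OF th f] s] by simp
      then have "(\<lambda>n. norm (?g n \<theta>) * D) \<longlonglongrightarrow> 0"
        by (intro tendsto_mult_left_zero tendsto_norm_zero) (simp add: LIM_zero)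
      moreover have "norm (ip (?g n \<theta>) (y n)) \<le> norm (?g n \<theta>) * D" for n
        using cmod_ip_le[of "?g n \<theta>" "y n"] mult_left_mono[OF y_le, of "norm (?g n \<theta>)"]
        by (meson norm_ge_zero order_trans)
      ultimately show "(\<lambda>n. ip (?g n \<theta>) (y n)) \<longlonglongrightarrow> 0"
        by (rule Lim_null_comparison[OF always_eventually[OF allI], rotated])
    qed
  qed auto
  moreover have "(\<integral>\<theta>. ip (?g n \<theta>) (y n) \<partial>W) = of_real ((norm (y n))\<^sup>2)" for n
    using int[of n] by (simp add: has_bochner_integral_integral_eq ip_self)
  ultimately have "(\<lambda>n. complex_of_real ((norm (y n))\<^sup>2)) \<longlonglongrightarrow> of_real 0" by simp
  then have "(\<lambda>n. (norm (y n))\<^sup>2) \<longlonglongrightarrow> 0" by (simp only: tendsto_of_real_iff)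
  then have "(\<lambda>n. sqrt ((norm (y n))\<^sup>2)) \<longlonglongrightarrow> sqrt 0" by (intro tendsto_intros)
  then have "y \<longlonglongrightarrow> 0" by (simp add: tendsto_norm_zero_iff)
  then show "(\<lambda>n. HCf f (s n)) \<longlonglongrightarrow> HCf f t" unfolding y_def by (simp add: LIM_zero_iff)
qed

lemma apply_HC: "apply_bcontfun (HC W R \<omega> F) = HCf (apply_bcontfun F)"
  unfolding HC_def HCf_def[symmetric, abs_def]
  by (rule apply_Bcontfun_compact[OF T_compact continuous_HCf]) simp

text \<open>
  Both sides are limits of Riemann sums over the same partitions of \<open>T\<close>. This interchanges the two
  integrations and shows in passing that the inner integral depends measurably on \<open>\<theta>\<close>.
\<close>

lemma sint_HCf:
  assumes mu: "\<mu> \<in> cabv" and f: "continuous_on UNIV f"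
  shows "has_bochner_integral W (\<lambda>\<theta>. sint ip (\<lambda>t. R (f (\<omega> t \<theta>)) \<theta>) \<mu>) (sint ip (HCf f) \<mu>)"
proof -
  let ?V = "measure (tv_measure \<mu>) UNIV"
  obtain q :: "nat \<Rightarrow> 't \<Rightarrow> 't" where q: "\<And>n. simple_function borel (q n)"
    "\<And>n t. dist (q n t) t < inverse (real (Suc n))"
    using compact_simple_tendsto_identity[OF T_compact] by blast
  have fin: "finite (range (q n))" for n using simple_functionD(1)[OF q(1)[of n]] by simp
  obtain C where C: "\<And>t. norm (f t) \<le> C" using continuous_bounded[OF f] by blast
  define S where "S n \<theta> = simple_sint ip (\<lambda>t. R (f (\<omega> (q n t) \<theta>)) \<theta>) \<mu>" for n \<theta>
  have S_eq: "S n \<theta> = (\<Sum>y\<in>range (q n). ip (R (f (\<omega> y \<theta>)) \<theta>) (\<mu> (q n -` {y})))" for n \<theta>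
    unfolding S_def by (rule simple_sint_compose[OF mu q(1) fin order_refl])
  have S_int: "has_bochner_integral W (S n) (simple_sint ip (\<lambda>t. HCf f (q n t)) \<mu>)" for n
    unfolding S_eq[abs_def] simple_sint_compose[OF mu q(1) fin order_refl]
    by (intro has_bochner_integral_sum HCf_ip f)
  have S_lim: "(\<lambda>n. S n \<theta>) \<longlonglongrightarrow> sint ip (\<lambda>t. R (f (\<omega> t \<theta>)) \<theta>) \<mu>" if th: "\<theta> \<in> space W" for \<theta>
    unfolding S_def
    by (rule simple_sint_tendsto_sint[OF mu simple_function_compose1[OF q(1)]
          uniform_limit_compose_near_identity[OF T_compact continuous_R_compose[OF th f] q(2)]])
  have S_meas: "S n \<in> borel_measurable W" for n using S_int[of n] by (auto simp: has_bochner_integral_iff)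
  have meas: "(\<lambda>\<theta>. sint ip (\<lambda>t. R (f (\<omega> t \<theta>)) \<theta>) \<mu>) \<in> borel_measurable W"
    by (rule borel_measurable_LIMSEQ_metric[OF S_meas S_lim])
  have w: "integrable W (\<lambda>\<theta>. nR \<theta> * C * ?V)" by (simp add: integrable_nR)
  have S_le: "norm (S n \<theta>) \<le> nR \<theta> * C * ?V" if "\<theta> \<in> space W" for n \<theta>
    unfolding S_def
    by (rule cmod_simple_sint_le[OF mu simple_function_compose1[OF q(1)] norm_R_le_bound[OF that C]])
  have lim: "AE \<theta> in W. (\<lambda>n. S n \<theta>) \<longlonglongrightarrow> sint ip (\<lambda>t. R (f (\<omega> t \<theta>)) \<theta>) \<mu>"
    using S_lim by (rule AE_I2)
  have bound: "AE \<theta> in W. norm (S n \<theta>) \<le> nR \<theta> * C * ?V" for n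
    using S_le by (rule AE_I2)
  have "(\<lambda>n. integral\<^sup>L W (S n)) \<longlonglongrightarrow> (\<integral>\<theta>. sint ip (\<lambda>t. R (f (\<omega> t \<theta>)) \<theta>) \<mu> \<partial>W)"
    by (rule integral_dominated_convergence[OF meas S_meas w lim bound])
  moreover have "integral\<^sup>L W (S n) = simple_sint ip (\<lambda>t. HCf f (q n t)) \<mu>" for n
    using S_int by (rule has_bochner_integral_integral_eq)
  moreover have "(\<lambda>n. simple_sint ip (\<lambda>t. HCf f (q n t)) \<mu>) \<longlonglongrightarrow> sint ip (HCf f) \<mu>"
    by (rule simple_sint_tendsto_sint[OF mu simple_function_compose1[OF q(1)]
          uniform_limit_compose_near_identity[OF T_compact continuous_HCf[OF f] q(2)]])
  ultimately have "(\<integral>\<theta>. sint ip (\<lambda>t. R (f (\<omega> t \<theta>)) \<theta>) \<mu> \<partial>W) = sint ip (HCf f) \<mu>"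
    using LIMSEQ_unique by fastforce
  then show ?thesis
    using integrable_dominated_convergence[OF meas S_meas w lim bound] by (simp add: has_bochner_integral_iff)
qed

section \<open>The transported measure\<close>

text \<open>
  For closed \<open>A\<close> the function is a limit of integrals of continuous functions, which are measurable
  in \<open>\<theta>\<close> by \<open>sint_HCf\<close>.
\<close>

lemma ip_vimage_measurable:
  assumes mu: "\<mu> \<in> cabv" and A: "A \<in> sets borel"
  shows "(\<lambda>\<theta>. ip (R x \<theta>) (\<mu> ((\<lambda>t. \<omega> t \<theta>) -` A))) \<in> borel_measurable W"
  using A
proof (induction A rule: borel_induct_closed)
  case (closed F)
  obtain h :: "nat \<Rightarrow> 't \<Rightarrow> real" where h: "\<And>n. continuous_on UNIV (h n)"
    "\<And>n t. 0 \<le> h n t \<and> h n t \<le> 1" "\<And>t. (\<lambda>n. h n t) \<longlonglongrightarrow> indicator F t"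
    using closed_indicator_limit[OF closed] by blast
  show ?case
  proof (rule borel_measurable_LIMSEQ_metric)
    show "(\<lambda>\<theta>. sint ip (\<lambda>t. R (h n (\<omega> t \<theta>) *\<^sub>R x) \<theta>) \<mu>) \<in> borel_measurable W" for n
    proof -
      have "continuous_on UNIV (\<lambda>t. h n t *\<^sub>R x)" by (intro continuous_intros h(1))
      from sint_HCf[OF mu this] show ?thesis by (simp add: has_bochner_integral_iff borel_measurable_integrable)
    qed
    fix \<theta> assume th: "\<theta> \<in> space W"
    have cont: "continuous_on UNIV (\<lambda>t. h n (\<omega> t \<theta>))" for n
      by (rule continuous_on_compose2[OF h(1) continuous_\<omega>[OF th]]) simp
    have "(\<lambda>n. sint ip (\<lambda>t. h n (\<omega> t \<theta>) *\<^sub>R R x \<theta>) \<mu>) \<longlonglongrightarrow> ip (R x \<theta>) (\<mu> ((\<lambda>t. \<omega> t \<theta>) -` F))"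
    proof (rule sint_tendsto_indicator[OF mu])
      show "unif_simple (\<lambda>t. h n (\<omega> t \<theta>) *\<^sub>R R x \<theta>)" for n
        by (intro unif_simple_continuous[OF T_compact] continuous_intros cont)
      show "(\<lambda>t. \<omega> t \<theta>) -` F \<in> sets borel" using closed by (intro vimage_\<omega>_borel[OF th]) simp
      show "(\<lambda>t. h n (\<omega> t \<theta>)) \<in> borel_measurable borel" for n
        by (rule borel_measurable_continuous_onI[OF cont])
      show "(\<lambda>n. h n (\<omega> t \<theta>)) \<longlonglongrightarrow> indicator ((\<lambda>t. \<omega> t \<theta>) -` F) t" for t
        using h(3)[of "\<omega> t \<theta>"] by (simp add: indicator_def)
    qed (use h(2) in auto)
    then show "(\<lambda>n. sint ip (\<lambda>t. R (h n (\<omega> t \<theta>) *\<^sub>R x) \<theta>) \<mu>)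
        \<longlonglongrightarrow> ip (R x \<theta>) (\<mu> ((\<lambda>t. \<omega> t \<theta>) -` F))"
      by (simp add: linear_scale[OF bounded_linear.linear[OF bounded_linear_R[OF th]]])
  qed
next
  case (compl A)
  have "(\<lambda>\<theta>. ip (R x \<theta>) (\<mu> UNIV) - ip (R x \<theta>) (\<mu> ((\<lambda>t. \<omega> t \<theta>) -` A))) \<in> borel_measurable W"
    by (intro borel_measurable_diff ip_R_measurable compl)
  then show ?case
    using compl(1) by (subst measurable_cong)
      (auto simp: vimage_Compl cabv_Compl[OF mu vimage_\<omega>_borel] ip.diff_right)
next
  case (union A)
  show ?case
  proof (rule borel_measurable_LIMSEQ_metric)
    show "(\<lambda>\<theta>. \<Sum>i<n. ip (R x \<theta>) (\<mu> ((\<lambda>t. \<omega> t \<theta>) -` A i))) \<in> borel_measurable W" for n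
      by (intro borel_measurable_sum union(3))
    fix \<theta> assume th: "\<theta> \<in> space W"
    have "(\<lambda>i. \<mu> ((\<lambda>t. \<omega> t \<theta>) -` A i)) sums \<mu> (\<Union>i. (\<lambda>t. \<omega> t \<theta>) -` A i)"
    proof (rule cabv_sums[OF mu])
      show "range (\<lambda>i. (\<lambda>t. \<omega> t \<theta>) -` A i) \<subseteq> sets borel" using union(1) vimage_\<omega>_borel[OF th] by auto
      show "disjoint_family (\<lambda>i. (\<lambda>t. \<omega> t \<theta>) -` A i)"
        using union(2) by (auto simp: disjoint_family_on_def disjoint_iff)
    qed
    then have "(\<lambda>i. ip (R x \<theta>) (\<mu> ((\<lambda>t. \<omega> t \<theta>) -` A i))) sums ip (R x \<theta>) (\<mu> ((\<lambda>t. \<omega> t \<theta>) -` (\<Union>i. A i)))"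
      unfolding vimage_UN by (rule bounded_linear.sums[OF ip.bounded_linear_right])
    then show "(\<lambda>n. \<Sum>i<n. ip (R x \<theta>) (\<mu> ((\<lambda>t. \<omega> t \<theta>) -` A i)))
        \<longlonglongrightarrow> ip (R x \<theta>) (\<mu> ((\<lambda>t. \<omega> t \<theta>) -` (\<Union>i. A i)))"
      unfolding sums_def .
  qed
qed

lemma cmod_ip_vimage_le:
  assumes mu: "\<mu> \<in> cabv" and th: "\<theta> \<in> space W"
  shows "cmod (ip (R x \<theta>) (\<mu> A)) \<le> nR \<theta> * norm x * measure (tv_measure \<mu>) A"
  by (rule order_trans[OF cmod_ip_le mult_mono[OF norm_R_le[OF th] norm_le_tv_measure[OF mu]]])
    (auto simp: nR_nonneg[OF th])

lemma ip_vimage_integrable: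
  assumes mu: "\<mu> \<in> cabv" and A: "A \<in> sets borel"
  shows "integrable W (\<lambda>\<theta>. ip (R x \<theta>) (\<mu> ((\<lambda>t. \<omega> t \<theta>) -` A)))"
proof (rule Bochner_Integration.integrable_bound[where f = "\<lambda>\<theta>. nR \<theta> * norm x * measure (tv_measure \<mu>) UNIV"])
  interpret finite_measure "tv_measure \<mu>" by (rule finite_measure_tv_measure[OF mu])
  show "AE \<theta> in W. norm (ip (R x \<theta>) (\<mu> ((\<lambda>t. \<omega> t \<theta>) -` A)))
      \<le> norm (nR \<theta> * norm x * measure (tv_measure \<mu>) UNIV)"
  proof (rule AE_I2)
    fix \<theta> assume th: "\<theta> \<in> space W"
    have "measure (tv_measure \<mu>) ((\<lambda>t. \<omega> t \<theta>) -` A) \<le> measure (tv_measure \<mu>) UNIV"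
      by (intro finite_measure_mono) auto
    then have "nR \<theta> * norm x * measure (tv_measure \<mu>) ((\<lambda>t. \<omega> t \<theta>) -` A)
        \<le> nR \<theta> * norm x * measure (tv_measure \<mu>) UNIV"
      by (intro mult_left_mono) (auto simp: nR_nonneg[OF th])
    also have "\<dots> = norm (nR \<theta> * norm x * measure (tv_measure \<mu>) UNIV)"
      by (simp add: abs_mult nR_nonneg[OF th])
    finally show "norm (ip (R x \<theta>) (\<mu> ((\<lambda>t. \<omega> t \<theta>) -` A)))
        \<le> norm (nR \<theta> * norm x * measure (tv_measure \<mu>) UNIV)"
      using cmod_ip_vimage_le[OF mu th] order_trans by blast
  qed
qed (simp_all add: integrable_nR ip_vimage_measurable[OF assms])

text \<open>
  Formally this is the average over \<open>\<theta>\<close> of the measures \<open>A \<mapsto> R\<^sub>\<theta>* (\<mu> (\<omega>\<^sub>\<theta> -` A))\<close>, with \<open>R\<^sub>\<theta>*\<close> the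
  adjoint operator. Passing to scalar products with all \<open>x\<close> moves the operator to the other side and
  leaves integrals of scalar functions only.
\<close>

definition transported :: "('t set \<Rightarrow> 'x) \<Rightarrow> 't set \<Rightarrow> 'x" where
  "transported \<mu> A = (if A \<in> sets borel
     then SOME y. \<forall>x. ip x y = (\<integral>\<theta>. ip (R x \<theta>) (\<mu> ((\<lambda>t. \<omega> t \<theta>) -` A)) \<partial>W) else 0)"

lemma ip_transported:
  assumes mu: "\<mu> \<in> cabv" and A: "A \<in> sets borel"
  shows "ip x (transported \<mu> A) = (\<integral>\<theta>. ip (R x \<theta>) (\<mu> ((\<lambda>t. \<omega> t \<theta>) -` A)) \<partial>W)"
proof -
  let ?b = "\<lambda>x \<theta>. ip (R x \<theta>) (\<mu> ((\<lambda>t. \<omega> t \<theta>) -` A))"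
  let ?\<phi> = "\<lambda>x. \<integral>\<theta>. ?b x \<theta> \<partial>W"
  note int = ip_vimage_integrable[OF mu A]
  interpret V: finite_measure "tv_measure \<mu>" by (rule finite_measure_tv_measure[OF mu])
  have "\<exists>y. \<forall>x. ip x y = ?\<phi> x"
  proof (rule riesz_representation)
    show "?\<phi> (x + y) = ?\<phi> x + ?\<phi> y" for x y
    proof -
      have "?\<phi> (x + y) = (\<integral>\<theta>. ?b x \<theta> + ?b y \<theta> \<partial>W)"
        by (intro Bochner_Integration.integral_cong)
          (auto simp: linear_add[OF bounded_linear.linear[OF bounded_linear_R]] ip.add_left)
      then show ?thesis by (simp add: int)
    qed
    show "?\<phi> (sc c x) = c * ?\<phi> x" if "c \<in> K" for c x
    proof -
      have "?\<phi> (sc c x) = (\<integral>\<theta>. c * ?b x \<theta> \<partial>W)"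
        using that by (intro Bochner_Integration.integral_cong) (auto simp: R_sc ip_sc_left)
      then show ?thesis by simp
    qed
    show "?\<phi> x \<in> K" for x
    proof (cases "K = UNIV")
      case False
      then have real: "z \<in> K \<longleftrightarrow> Im z = 0" for z using K_cases by (auto simp: complex_is_Real_iff)
      have "Im (?\<phi> x) = (\<integral>\<theta>. Im (?b x \<theta>) \<partial>W)" by (rule integral_Im[symmetric, OF int])
      also have "\<dots> = 0" using ip_in_K by (simp add: real)
      finally show ?thesis by (simp add: real)
    qed simp
    show "cmod (?\<phi> x) \<le> (\<integral>\<theta>. nR \<theta> * measure (tv_measure \<mu>) UNIV \<partial>W) * norm x" for x
    proof -
      have "cmod (?\<phi> x) \<le> (\<integral>\<theta>. cmod (?b x \<theta>) \<partial>W)" by (rule integral_norm_bound)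
      also have "\<dots> \<le> (\<integral>\<theta>. nR \<theta> * measure (tv_measure \<mu>) UNIV * norm x \<partial>W)"
      proof (rule integral_mono)
        fix \<theta> assume th: "\<theta> \<in> space W"
        have "cmod (?b x \<theta>) \<le> nR \<theta> * norm x * measure (tv_measure \<mu>) ((\<lambda>t. \<omega> t \<theta>) -` A)"
          by (rule cmod_ip_vimage_le[OF mu th])
        also have "\<dots> \<le> nR \<theta> * norm x * measure (tv_measure \<mu>) UNIV"
          by (intro mult_left_mono V.finite_measure_mono) (auto simp: nR_nonneg[OF th])
        finally show "cmod (?b x \<theta>) \<le> nR \<theta> * measure (tv_measure \<mu>) UNIV * norm x"
          by (simp add: mult_ac)
      qed (simp_all add: int integrable_nR)
      finally show ?thesis by simp
    qed
  qed
  then show ?thesis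
    using someI_ex[of "\<lambda>y. \<forall>x. ip x y = ?\<phi> x"] A by (simp add: transported_def)
qed

lemma emeasure_vimage_measurable:
  assumes mu: "\<mu> \<in> cabv" and A: "A \<in> sets borel"
  shows "(\<lambda>\<theta>. emeasure (tv_measure \<mu>) ((\<lambda>t. \<omega> t \<theta>) -` A)) \<in> borel_measurable W"
proof -
  interpret V: finite_measure "tv_measure \<mu>" by (rule finite_measure_tv_measure[OF mu])
  have "sets (tv_measure \<mu> \<Otimes>\<^sub>M W) = sets (borel \<Otimes>\<^sub>M W)"
    by (rule sets_pair_measure_cong) simp_all
  then have "(\<lambda>(t, \<theta>). \<omega> t \<theta>) \<in> measurable (tv_measure \<mu> \<Otimes>\<^sub>M W) borel"
    using \<omega>_measurable measurable_cong_sets[OF _ refl] by blast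
  then have swap: "(\<lambda>(\<theta>, t). \<omega> t \<theta>) \<in> measurable (W \<Otimes>\<^sub>M tv_measure \<mu>) borel"
    using measurable_pair_swap[of "\<lambda>(t, \<theta>). \<omega> t \<theta>"] by simp
  note meas = V.measurable_emeasure_Pair[OF measurable_sets[OF swap A]]
  show ?thesis
  proof (rule measurable_cong[THEN iffD1, OF _ meas])
    fix \<theta> assume "\<theta> \<in> space W"
    then have "Pair \<theta> -` ((\<lambda>(\<theta>, t). \<omega> t \<theta>) -` A \<inter> space (W \<Otimes>\<^sub>M tv_measure \<mu>)) = (\<lambda>t. \<omega> t \<theta>) -` A"
      by (auto simp: space_pair_measure)
    then show "emeasure (tv_measure \<mu>) (Pair \<theta> -` ((\<lambda>(\<theta>, t). \<omega> t \<theta>) -` A \<inter> space (W \<Otimes>\<^sub>M tv_measure \<mu>)))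
        = emeasure (tv_measure \<mu>) ((\<lambda>t. \<omega> t \<theta>) -` A)" by simp
  qed
qed

text \<open>
  The image measures of the variation of \<open>\<mu>\<close> under the maps \<open>\<omega> _ \<theta>\<close>, averaged with the weight
  \<open>nR \<theta>\<close>. It dominates \<open>transported \<mu>\<close> and so provides countable additivity and finite variation.
\<close>

definition transported_variation :: "('t set \<Rightarrow> 'x) \<Rightarrow> 't measure" where
  "transported_variation \<mu> = measure_of UNIV (sets borel)
     (\<lambda>A. \<integral>\<^sup>+\<theta>. ennreal (nR \<theta>) * emeasure (tv_measure \<mu>) ((\<lambda>t. \<omega> t \<theta>) -` A) \<partial>W)"

lemma sets_transported_variation: "sets (transported_variation \<mu>) = sets borel"
  unfolding transported_variation_def using sets.sigma_sets_eq[of borel] by simp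

lemma emeasure_transported_variation:
  assumes mu: "\<mu> \<in> cabv" and A: "A \<in> sets borel"
  shows "emeasure (transported_variation \<mu>) A
    = (\<integral>\<^sup>+\<theta>. ennreal (nR \<theta>) * emeasure (tv_measure \<mu>) ((\<lambda>t. \<omega> t \<theta>) -` A) \<partial>W)"
  unfolding transported_variation_def
proof (rule emeasure_measure_of_sigma)
  let ?m = "\<lambda>A. \<integral>\<^sup>+\<theta>. ennreal (nR \<theta>) * emeasure (tv_measure \<mu>) ((\<lambda>t. \<omega> t \<theta>) -` A) \<partial>W"
  show "sigma_algebra UNIV (sets (borel :: 't measure))"
    using sets.sigma_algebra_axioms[of "borel :: 't measure"] by simp
  show "positive (sets borel) ?m" by (simp add: positive_def)
  show "countably_additive (sets borel) ?m"
    unfolding countably_additive_def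
  proof (intro allI impI)
    fix A :: "nat \<Rightarrow> 't set"
    assume A: "range A \<subseteq> sets borel" "disjoint_family A"
    have "(\<Sum>i. ?m (A i)) = (\<integral>\<^sup>+\<theta>. (\<Sum>i. ennreal (nR \<theta>) * emeasure (tv_measure \<mu>) ((\<lambda>t. \<omega> t \<theta>) -` A i)) \<partial>W)"
    proof (rule nn_integral_suminf[symmetric])
      fix i
      have "A i \<in> sets borel" using A(1) by auto
      from emeasure_vimage_measurable[OF mu this] norm_R_measurable
      show "(\<lambda>\<theta>. ennreal (nR \<theta>) * emeasure (tv_measure \<mu>) ((\<lambda>t. \<omega> t \<theta>) -` A i)) \<in> borel_measurable W"
        by (intro borel_measurable_times_ennreal measurable_compose[OF _ measurable_ennreal])
    qed
    also have "\<dots> = ?m (\<Union>i. A i)"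
    proof (rule nn_integral_cong)
      fix \<theta> assume th: "\<theta> \<in> space W"
      have "(\<Sum>i. emeasure (tv_measure \<mu>) ((\<lambda>t. \<omega> t \<theta>) -` A i))
          = emeasure (tv_measure \<mu>) (\<Union>i. (\<lambda>t. \<omega> t \<theta>) -` A i)"
        using A vimage_\<omega>_borel[OF th]
        by (intro suminf_emeasure) (auto simp: disjoint_family_on_def disjoint_iff)
      then show "(\<Sum>i. ennreal (nR \<theta>) * emeasure (tv_measure \<mu>) ((\<lambda>t. \<omega> t \<theta>) -` A i))
          = ennreal (nR \<theta>) * emeasure (tv_measure \<mu>) ((\<lambda>t. \<omega> t \<theta>) -` (\<Union>i. A i))"
        by (simp add: vimage_UN)
    qed
    finally show "(\<Sum>i. ?m (A i)) = ?m (\<Union>i. A i)" .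
  qed
qed (rule A)

lemma finite_measure_transported_variation:
  assumes mu: "\<mu> \<in> cabv" shows "finite_measure (transported_variation \<mu>)"
proof
  interpret V: finite_measure "tv_measure \<mu>" by (rule finite_measure_tv_measure[OF mu])
  have "emeasure (transported_variation \<mu>) UNIV = (\<integral>\<^sup>+\<theta>. ennreal (nR \<theta>) \<partial>W) * emeasure (tv_measure \<mu>) UNIV"
    using norm_R_measurable by (simp add: emeasure_transported_variation[OF mu] nn_integral_multc)
  also have "\<dots> < \<infinity>"
    by (simp add: V.emeasure_eq_measure nn_integral_eq_integral[OF integrable_nR AE_I2] nR_nonneg
        ennreal_mult_less_top)
  finally show "emeasure (transported_variation \<mu>) (space (transported_variation \<mu>)) \<noteq> \<infinity>"
    by (simp add: sets_eq_imp_space_eq[OF sets_transported_variation])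
qed

text \<open>The norm of \<open>transported \<mu> A\<close> is found by inserting this vector for \<open>x\<close> in the weak formula.\<close>

lemma norm_transported_le:
  assumes mu: "\<mu> \<in> cabv" and A: "A \<in> sets borel"
  shows "norm (transported \<mu> A) \<le> measure (transported_variation \<mu>) A"
proof -
  interpret V: finite_measure "tv_measure \<mu>" by (rule finite_measure_tv_measure[OF mu])
  interpret D: finite_measure "transported_variation \<mu>" by (rule finite_measure_transported_variation[OF mu])
  define z where "z = transported \<mu> A"
  have "ennreal ((norm z)\<^sup>2) = ennreal (norm (ip z z))" by (simp add: ip_self norm_power)
  also have "\<dots> \<le> (\<integral>\<^sup>+\<theta>. ennreal (norm (ip (R z \<theta>) (\<mu> ((\<lambda>t. \<omega> t \<theta>) -` A)))) \<partial>W)"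
    unfolding z_def ip_transported[OF mu A] by (rule integral_norm_bound_ennreal[OF ip_vimage_integrable[OF mu A]])
  also have "\<dots> \<le> (\<integral>\<^sup>+\<theta>. ennreal (norm z) *
      (ennreal (nR \<theta>) * emeasure (tv_measure \<mu>) ((\<lambda>t. \<omega> t \<theta>) -` A)) \<partial>W)"
  proof (rule nn_integral_mono)
    fix \<theta> assume th: "\<theta> \<in> space W"
    show "ennreal (norm (ip (R z \<theta>) (\<mu> ((\<lambda>t. \<omega> t \<theta>) -` A))))
      \<le> ennreal (norm z) * (ennreal (nR \<theta>) * emeasure (tv_measure \<mu>) ((\<lambda>t. \<omega> t \<theta>) -` A))"
      using cmod_ip_vimage_le[OF mu th, of z "(\<lambda>t. \<omega> t \<theta>) -` A"] nR_nonneg[OF th]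
      by (simp add: V.emeasure_eq_measure ennreal_mult[symmetric] mult_ac ennreal_leI)
  qed
  also have "\<dots> = ennreal (norm z) * emeasure (transported_variation \<mu>) A"
    unfolding emeasure_transported_variation[OF mu A] using norm_R_measurable emeasure_vimage_measurable[OF mu A]
    by (intro nn_integral_cmult borel_measurable_times_ennreal measurable_compose[OF _ measurable_ennreal])
  also have "\<dots> = ennreal (norm z * measure (transported_variation \<mu>) A)"
    by (simp add: D.emeasure_eq_measure ennreal_mult)
  finally have "norm z * norm z \<le> norm z * measure (transported_variation \<mu>) A"
    by (simp add: power2_eq_square)
  then show ?thesis
    unfolding z_def[symmetric] by (cases "z = 0") auto
qed

lemma transported_cabv:
  assumes mu: "\<mu> \<in> cabv" shows "transported \<mu> \<in> cabv"
proof (rule cabvI)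
  fix A B :: "'t set" assume AB: "A \<in> sets borel" "B \<in> sets borel" "A \<inter> B = {}"
  show "transported \<mu> (A \<union> B) = transported \<mu> A + transported \<mu> B"
  proof (rule ip_ext)
    fix x
    have "ip x (transported \<mu> (A \<union> B)) = (\<integral>\<theta>. ip (R x \<theta>) (\<mu> ((\<lambda>t. \<omega> t \<theta>) -` A))
        + ip (R x \<theta>) (\<mu> ((\<lambda>t. \<omega> t \<theta>) -` B)) \<partial>W)"
      unfolding ip_transported[OF mu sets.Un[OF AB(1,2)]]
    proof (rule Bochner_Integration.integral_cong[OF refl])
      fix \<theta> assume th: "\<theta> \<in> space W"
      have "\<mu> ((\<lambda>t. \<omega> t \<theta>) -` A \<union> (\<lambda>t. \<omega> t \<theta>) -` B)
          = \<mu> ((\<lambda>t. \<omega> t \<theta>) -` A) + \<mu> ((\<lambda>t. \<omega> t \<theta>) -` B)"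
        using AB by (intro cabv_Un[OF mu] vimage_\<omega>_borel[OF th]) auto
      then show "ip (R x \<theta>) (\<mu> ((\<lambda>t. \<omega> t \<theta>) -` (A \<union> B)))
          = ip (R x \<theta>) (\<mu> ((\<lambda>t. \<omega> t \<theta>) -` A)) + ip (R x \<theta>) (\<mu> ((\<lambda>t. \<omega> t \<theta>) -` B))"
        by (simp add: vimage_Un ip.add_right)
    qed
    then show "ip x (transported \<mu> (A \<union> B)) = ip x (transported \<mu> A + transported \<mu> B)"
      using AB by (simp add: ip.add_right ip_transported[OF mu] ip_vimage_integrable[OF mu])
  qed
next
  show "finite_measure (transported_variation \<mu>)" "sets (transported_variation \<mu>) = sets borel"
    by (rule finite_measure_transported_variation[OF mu]) (rule sets_transported_variation)
  show "norm (transported \<mu> A) \<le> measure (transported_variation \<mu>) A" if "A \<in> sets borel" for A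
    by (rule norm_transported_le[OF mu that])
qed (simp add: transported_def)

text \<open>
  The duality between \<open>transported\<close> and \<open>HCf\<close>. For \<open>f \<circ> q n\<close> in place of \<open>f\<close> the left-hand side is an
  integral over \<open>\<theta>\<close> of integrals of simple functions against \<open>\<mu>\<close>; as \<open>n\<close> grows, dominated convergence
  leads to the iterated integral of \<open>sint_HCf\<close>.
\<close>

lemma sint_transported:
  assumes mu: "\<mu> \<in> cabv" and f: "continuous_on UNIV f"
  shows "sint ip f (transported \<mu>) = sint ip (HCf f) \<mu>"
proof -
  let ?V = "measure (tv_measure \<mu>) UNIV"
  note nu = transported_cabv[OF mu]
  obtain q :: "nat \<Rightarrow> 't \<Rightarrow> 't" where q: "\<And>n. simple_function borel (q n)"
    "\<And>n t. dist (q n t) t < inverse (real (Suc n))"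
    using compact_simple_tendsto_identity[OF T_compact] by blast
  have fin: "finite (range (q n))" for n using simple_functionD(1)[OF q(1)[of n]] by simp
  have q_sets: "q n -` {y} \<in> sets borel" for n y using simple_functionD(2)[OF q(1)[of n], of "{y}"] by simp
  obtain C where C: "\<And>t. norm (f t) \<le> C" using continuous_bounded[OF f] by blast
  define S where "S n \<theta> = (\<Sum>y\<in>range (q n). ip (R (f y) \<theta>) (\<mu> ((\<lambda>t. \<omega> t \<theta>) -` (q n -` {y}))))" for n \<theta>
  have q\<omega>: "simple_function borel (\<lambda>t. q n (\<omega> t \<theta>))" if th: "\<theta> \<in> space W" for n \<theta>
  proof (rule simple_function_borel_measurable)
    show "finite ((\<lambda>t. q n (\<omega> t \<theta>)) ` space borel)" by (rule finite_subset[OF _ fin[of n]]) auto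
    show "(\<lambda>t. q n (\<omega> t \<theta>)) \<in> borel_measurable borel"
      by (rule measurable_compose[OF borel_measurable_continuous_onI[OF continuous_\<omega>[OF th]]
            borel_measurable_simple_function[OF q(1)]])
  qed
  have S_eq: "S n \<theta> = simple_sint ip (\<lambda>t. R (f (q n (\<omega> t \<theta>))) \<theta>) \<mu>" if th: "\<theta> \<in> space W" for n \<theta>
  proof -
    have "range (\<lambda>t. q n (\<omega> t \<theta>)) \<subseteq> range (q n)" by auto
    from simple_sint_compose[OF mu q\<omega>[OF th] fin[of n] this, of "\<lambda>y. R (f y) \<theta>"]
    show ?thesis by (simp add: S_def vimage_def)
  qed
  have S_int: "integral\<^sup>L W (S n) = simple_sint ip (\<lambda>t. f (q n t)) (transported \<mu>)" for n
    unfolding S_def[abs_def] simple_sint_compose[OF nu q(1) fin order_refl]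
    by (simp add: ip_transported[OF mu q_sets] ip_vimage_integrable[OF mu q_sets])
  have S_meas: "S n \<in> borel_measurable W" for n
    unfolding S_def[abs_def] by (intro borel_measurable_sum ip_vimage_measurable[OF mu q_sets])
  have meas: "(\<lambda>\<theta>. sint ip (\<lambda>t. R (f (\<omega> t \<theta>)) \<theta>) \<mu>) \<in> borel_measurable W"
    using sint_HCf[OF mu f] by (auto simp: has_bochner_integral_iff)
  have "(\<lambda>n. S n \<theta>) \<longlonglongrightarrow> sint ip (\<lambda>t. R (f (\<omega> t \<theta>)) \<theta>) \<mu>" if th: "\<theta> \<in> space W" for \<theta>
  proof -
    have "uniform_limit UNIV (\<lambda>n t. f (q n t)) f sequentially"
      by (rule uniform_limit_compose_near_identity[OF T_compact f q(2)])
    then have "uniform_limit UNIV (\<lambda>n t. f (q n (\<omega> t \<theta>))) (\<lambda>t. f (\<omega> t \<theta>)) sequentially"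
      by (rule uniform_limit_compose'[where h = "\<lambda>t. \<omega> t \<theta>"]) simp
    then have "uniform_limit UNIV (\<lambda>n t. R (f (q n (\<omega> t \<theta>))) \<theta>) (\<lambda>t. R (f (\<omega> t \<theta>)) \<theta>) sequentially"
      by (rule bounded_linear.uniform_limit[OF bounded_linear_R[OF th]])
    then show ?thesis
      unfolding S_eq[OF th] by (rule simple_sint_tendsto_sint[OF mu simple_function_compose1[OF q\<omega>[OF th]]])
  qed
  then have lim: "AE \<theta> in W. (\<lambda>n. S n \<theta>) \<longlonglongrightarrow> sint ip (\<lambda>t. R (f (\<omega> t \<theta>)) \<theta>) \<mu>"
    by (rule AE_I2)
  have bound: "AE \<theta> in W. norm (S n \<theta>) \<le> nR \<theta> * C * ?V" for n
  proof (rule AE_I2)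
    fix \<theta> assume th: "\<theta> \<in> space W"
    show "norm (S n \<theta>) \<le> nR \<theta> * C * ?V"
      unfolding S_eq[OF th]
      by (rule cmod_simple_sint_le[OF mu simple_function_compose1[OF q\<omega>[OF th]] norm_R_le_bound[OF th C]])
  qed
  have w: "integrable W (\<lambda>\<theta>. nR \<theta> * C * ?V)" by (simp add: integrable_nR)
  have "(\<lambda>n. integral\<^sup>L W (S n)) \<longlonglongrightarrow> (\<integral>\<theta>. sint ip (\<lambda>t. R (f (\<omega> t \<theta>)) \<theta>) \<mu> \<partial>W)"
    by (rule integral_dominated_convergence[OF meas S_meas w lim bound])
  moreover have "(\<lambda>n. integral\<^sup>L W (S n)) \<longlonglongrightarrow> sint ip f (transported \<mu>)"
    unfolding S_int by (rule simple_sint_tendsto_sint[OF nu simple_function_compose1[OF q(1)]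
          uniform_limit_compose_near_identity[OF T_compact f q(2)]])
  ultimately show ?thesis
    using LIMSEQ_unique has_bochner_integral_integral_eq[OF sint_HCf[OF mu f]] by metis
qed

text \<open>
  As \<open>Phi ip\<close> is injective on \<open>cabv\<close>, the explicit preimage \<open>transported \<mu>\<close> is the one chosen by
  \<open>inv_into\<close>.
\<close>

lemma Hop_eq_transported:
  assumes mu: "\<mu> \<in> cabv" shows "Hop ip W R \<omega> \<mu> = transported \<mu>"
proof -
  have "HC_adjoint W R \<omega> (Phi ip \<mu>) = Phi ip (transported \<mu>)"
    by (rule ext) (simp add: HC_adjoint_def Phi_def apply_HC sint_transported[OF mu])
  then show ?thesis
    by (simp add: Hop_def inv_into_f_f[OF inj_on_Phi[OF T_compact] transported_cabv[OF mu]])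
qed

end

section \<open>Linearity\<close>

lemma cabv_linear_combination:
  assumes mu: "\<mu> \<in> cabv" and nu: "\<nu> \<in> cabv" and L: "bounded_linear L" and M: "bounded_linear M"
  shows "(\<lambda>A. L (\<mu> A) + M (\<nu> A)) \<in> cabv"
proof -
  have "L (\<mu> A) + M (\<nu> A) = 0" if "A \<notin> sets borel" for A
    using that by (simp add: cabv_outside[OF mu] cabv_outside[OF nu]
        linear_0[OF bounded_linear.linear[OF L]] linear_0[OF bounded_linear.linear[OF M]])
  moreover have "(\<lambda>i. L (\<mu> (A i)) + M (\<nu> (A i))) sums (L (\<mu> (\<Union>i. A i)) + M (\<nu> (\<Union>i. A i)))"
    if "range A \<subseteq> sets borel" "disjoint_family A" for A :: "nat \<Rightarrow> _"
    using that by (intro sums_add bounded_linear.sums[OF L] bounded_linear.sums[OF M] cabv_sums mu nu)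
  moreover have "total_variation (\<lambda>A. L (\<mu> A) + M (\<nu> A)) UNIV < \<infinity>"
  proof -
    let ?b = "ennreal (onorm L) * total_variation \<mu> UNIV + ennreal (onorm M) * total_variation \<nu> UNIV"
    have "total_variation (\<lambda>A. L (\<mu> A) + M (\<nu> A)) UNIV \<le> ?b"
      unfolding total_variation_def[of "\<lambda>A. L (\<mu> A) + M (\<nu> A)"]
    proof (rule SUP_least)
      fix P :: "'a set set" assume "P \<in> {P. finite P \<and> P \<subseteq> sets borel \<and> disjoint P \<and> \<Union>P = UNIV}"
      then have P: "finite P" "P \<subseteq> sets borel" "disjoint P" "\<Union>P = UNIV" by auto
      have "ennreal (norm (L x + M y)) \<le> ennreal (onorm L) * ennreal (norm x) + ennreal (onorm M) * ennreal (norm y)" for x y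
      proof -
        have "norm (L x + M y) \<le> onorm L * norm x + onorm M * norm y"
          using norm_triangle_ineq[of "L x" "M y"] onorm[OF L, of x] onorm[OF M, of y] by linarith
        then have "ennreal (norm (L x + M y)) \<le> ennreal (onorm L * norm x + onorm M * norm y)"
          by (rule ennreal_leI)
        also have "\<dots> = ennreal (onorm L) * ennreal (norm x) + ennreal (onorm M) * ennreal (norm y)"
          by (simp add: ennreal_mult[symmetric] onorm_pos_le[OF L] onorm_pos_le[OF M])
        finally show ?thesis .
      qed
      then have "(\<Sum>B\<in>P. ennreal (norm (L (\<mu> B) + M (\<nu> B))))
          \<le> (\<Sum>B\<in>P. ennreal (onorm L) * ennreal (norm (\<mu> B)) + ennreal (onorm M) * ennreal (norm (\<nu> B)))"
        by (intro sum_mono)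
      also have "\<dots> = ennreal (onorm L) * (\<Sum>B\<in>P. ennreal (norm (\<mu> B)))
          + ennreal (onorm M) * (\<Sum>B\<in>P. ennreal (norm (\<nu> B)))"
        by (simp only: sum.distrib sum_distrib_left)
      also have "\<dots> \<le> ?b"
        using P by (intro add_mono mult_left_mono sum_norm_le_total_variation) auto
      finally show "(\<Sum>B\<in>P. ennreal (norm (L (\<mu> B) + M (\<nu> B)))) \<le> ?b" .
    qed
    also have "?b < \<infinity>" using mu nu by (simp add: cabv_def ennreal_mult_less_top)
    finally show ?thesis .
  qed
  ultimately show ?thesis by (simp add: cabv_def)
qed

lemma cabv_add: "\<mu> \<in> cabv \<Longrightarrow> \<nu> \<in> cabv \<Longrightarrow> (\<lambda>A. \<mu> A + \<nu> A) \<in> cabv"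
  by (rule cabv_linear_combination) (auto intro: bounded_linear_ident)

lemma cabv_diff: "\<mu> \<in> cabv \<Longrightarrow> \<nu> \<in> cabv \<Longrightarrow> (\<lambda>A. \<mu> A - \<nu> A) \<in> cabv"
  using cabv_linear_combination[of \<mu> \<nu> "\<lambda>x. x" "\<lambda>x. - x"]
  by (simp add: bounded_linear_ident bounded_linear_minus)

lemma (in hilbert_space_over) bounded_linear_sc:
  assumes c: "c \<in> K" shows "bounded_linear (sc c)"
proof (rule bounded_linear_intro)
  fix r x
  show "sc c (r *\<^sub>R x) = r *\<^sub>R sc c x"
    using c of_real_in_K[of r] by (simp add: sc_of_real[symmetric] sc_sc mult.commute)
  show "norm (sc c x) \<le> norm x * cmod c" using norm_sc[OF c] by simp
qed (rule sc_add_right[OF c])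

lemma (in hilbert_space_over) cabv_sc:
  assumes "c \<in> K" "\<mu> \<in> cabv" shows "(\<lambda>A. sc c (\<mu> A)) \<in> cabv"
  using cabv_linear_combination[OF assms(2,2) bounded_linear_sc[OF assms(1)] bounded_linear_zero] by simp

text \<open>
  By the weak formula \<open>ip_transported\<close>, linearity only involves the linearity of the integral over \<open>\<theta>\<close>.
\<close>

context random_operators
begin

lemma transported_add:
  assumes mu: "\<mu> \<in> cabv" and nu: "\<nu> \<in> cabv"
  shows "transported (\<lambda>A. \<mu> A + \<nu> A) = (\<lambda>A. transported \<mu> A + transported \<nu> A)"
  by (rule cabv_eqI)
    (simp_all add: transported_cabv cabv_add mu nu ip_transported ip.add_right ip_vimage_integrable)

lemma transported_diff:
  assumes mu: "\<mu> \<in> cabv" and nu: "\<nu> \<in> cabv"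
  shows "transported (\<lambda>A. \<mu> A - \<nu> A) = (\<lambda>A. transported \<mu> A - transported \<nu> A)"
  by (rule cabv_eqI)
    (simp_all add: transported_cabv cabv_diff mu nu ip_transported ip.diff_right ip_vimage_integrable)

lemma transported_sc:
  assumes c: "c \<in> K" and mu: "\<mu> \<in> cabv"
  shows "transported (\<lambda>A. sc c (\<mu> A)) = (\<lambda>A. sc c (transported \<mu> A))"
  by (rule cabv_eqI)
    (simp_all add: transported_cabv cabv_sc c mu ip_transported ip_sc_right)

lemma transported_cabv0:
  assumes "\<mu> \<in> cabv0" shows "transported \<mu> \<in> cabv0"
proof -
  have mu: "\<mu> \<in> cabv" "\<mu> UNIV = 0" using assms by (auto simp: cabv0_def)
  have "transported \<mu> UNIV = 0"
    by (rule ip_ext) (simp add: ip_transported[OF mu(1)] mu(2) ip.zero_right)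
  then show ?thesis by (simp add: cabv0_def transported_cabv[OF mu(1)])
qed

end


section \<open>The Monge-Kantorovich norm\<close>

context random_operators
begin

lemma mk_norm_eq: "mk_norm ip \<mu> = (SUP f\<in>{f :: 't \<Rightarrow> 'x. 1-lipschitz_on UNIV f}. cmod (sint ip f \<mu>))"
proof -
  have "{f :: 't \<Rightarrow> 'x. (\<exists>C. C-lipschitz_on UNIV f) \<and> lip_const f \<le> 1} = {f. 1-lipschitz_on UNIV f}"
  proof (intro Collect_cong iffI conjI)
    fix f :: "'t \<Rightarrow> 'x"
    assume "(\<exists>C. C-lipschitz_on UNIV f) \<and> lip_const f \<le> 1"
    then obtain C where f: "C-lipschitz_on UNIV f" "lip_const f \<le> 1" by blast
    show "1-lipschitz_on UNIV f"
    proof (rule lipschitz_onI)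
      fix s t show "dist (f s) (f t) \<le> 1 * dist s t"
        using dist_le_lip_const[OF f(1), of s t] mult_right_mono[OF f(2), of "dist s t"] by simp
    qed simp
  qed (use lip_const_le[OF _ T_two_elements] in auto)
  then show ?thesis unfolding mk_norm_def by simp
qed

lemma mk_norm_bdd:
  assumes "\<mu> \<in> cabv0"
  shows "bdd_above ((\<lambda>f. cmod (sint ip f \<mu>)) ` {f :: 't \<Rightarrow> 'x. 1-lipschitz_on UNIV f})"
proof -
  have mu: "\<mu> \<in> cabv" "\<mu> UNIV = 0" using assms by (auto simp: cabv0_def)
  obtain t\<^sub>0 :: 't where True by blast
  obtain D where D: "\<And>t :: 't. dist t\<^sub>0 t \<le> D"
    using compact_imp_bounded[OF T_compact] bounded_any_center[of UNIV t\<^sub>0] by auto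
  have "cmod (sint ip f \<mu>) \<le> D * measure (tv_measure \<mu>) UNIV" if f: "1-lipschitz_on UNIV f" for f :: "'t \<Rightarrow> 'x"
  proof -
    have us: "unif_simple f"
      by (rule unif_simple_continuous[OF T_compact lipschitz_on_continuous_on[OF f]])
    have c: "unif_simple (\<lambda>_ :: 't. f t\<^sub>0)" by (rule unif_simple_simple) simp
    \<comment> \<open>constants integrate to zero, as the total mass is zero\<close>
    have "sint ip f \<mu> = sint ip (\<lambda>t. f t - f t\<^sub>0) \<mu>"
      by (simp add: sint_diff[OF mu(1) us c] sint_const[OF mu(1)] mu(2) ip.zero_right)
    also have "cmod \<dots> \<le> D * measure (tv_measure \<mu>) UNIV"
    proof (rule cmod_sint_le[OF mu(1) unif_simple_diff[OF us c]])
      fix t show "norm (f t - f t\<^sub>0) \<le> D"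
        using lipschitz_onD[OF f, of t t\<^sub>0] D[of t] by (simp add: dist_norm dist_commute)
    qed
    finally show ?thesis .
  qed
  then show ?thesis by (auto intro!: bdd_aboveI)
qed

lemma cmod_sint_le_mk_norm:
  fixes f :: "'t \<Rightarrow> 'x"
  assumes "\<mu> \<in> cabv0" "1-lipschitz_on UNIV f"
  shows "cmod (sint ip f \<mu>) \<le> mk_norm ip \<mu>"
  unfolding mk_norm_eq using assms(2) by (intro cSUP_upper[OF _ mk_norm_bdd[OF assms(1)]]) auto

lemma mk_norm_nonneg:
  fixes \<mu> :: "'t set \<Rightarrow> 'x"
  assumes "\<mu> \<in> cabv0" shows "0 \<le> mk_norm ip \<mu>"
proof -
  have "1-lipschitz_on UNIV (\<lambda>_ :: 't. 0 :: 'x)" by (simp add: lipschitz_on_def)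
  from cmod_sint_le_mk_norm[OF assms this] show ?thesis using norm_ge_zero order_trans by blast
qed

lemma cmod_sint_le_lipschitz:
  fixes f :: "'t \<Rightarrow> 'x"
  assumes mu: "\<mu> \<in> cabv0" and f: "C-lipschitz_on UNIV f"
  shows "cmod (sint ip f \<mu>) \<le> C * mk_norm ip \<mu>"
proof (cases "C = 0")
  case True
  obtain t\<^sub>0 :: 't where True by blast
  \<comment> \<open>rescaling is impossible, but \<open>f\<close> is constant and integrates to zero\<close>
  have "f = (\<lambda>_. f t\<^sub>0)" using lipschitz_onD[OF f] True by fastforce
  then show ?thesis
    using sint_const[of \<mu> "f t\<^sub>0"] mu True by (simp add: cabv0_def ip.zero_right)
next
  case False
  then have C: "0 < C" using lipschitz_on_nonneg[OF f] by simp
  have mu': "\<mu> \<in> cabv" using mu by (simp add: cabv0_def)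
  have us: "unif_simple f"
    by (rule unif_simple_continuous[OF T_compact lipschitz_on_continuous_on[OF f]])
  have "1-lipschitz_on UNIV (\<lambda>t. (1 / C) *\<^sub>R f t)"
    using lipschitz_on_cmult[OF f, of "1 / C"] C by simp
  from cmod_sint_le_mk_norm[OF mu this] show ?thesis
    using C by (simp add: sint_scaleR[OF mu' us] norm_mult field_simps)
qed

text \<open>
  The averaging operator \<open>HCf\<close> multiplies Lipschitz constants by at most the integral of
  \<open>nR * r\<close>; by duality this bounds the transport of measures.
\<close>

lemma lipschitz_HCf:
  assumes f: "1-lipschitz_on UNIV f"
  shows "(\<integral>\<theta>. nR \<theta> * r \<theta> \<partial>W)-lipschitz_on UNIV (HCf f)"
proof (rule lipschitz_onI)
  fix s t
  have "norm (HCf f s - HCf f t) \<le> (\<integral>\<theta>. nR \<theta> * r \<theta> * dist s t \<partial>W)"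
  proof (rule weak_integral_norm_le[OF HCf_diff_ip[OF lipschitz_on_continuous_on[OF f]]])
    fix \<theta> assume th: "\<theta> \<in> space W"
    have "norm (f (\<omega> s \<theta>) - f (\<omega> t \<theta>)) \<le> r \<theta> * dist s t"
      using lipschitz_onD[OF f, of "\<omega> s \<theta>" "\<omega> t \<theta>"] dist_\<omega>_le[OF th, of s t] by (simp add: dist_norm)
    from mult_left_mono[OF this nR_nonneg[OF th]] norm_R_diff_le[OF th, of "f (\<omega> s \<theta>)" "f (\<omega> t \<theta>)"]
    show "norm (R (f (\<omega> s \<theta>)) \<theta> - R (f (\<omega> t \<theta>)) \<theta>) \<le> nR \<theta> * r \<theta> * dist s t" by (simp add: mult.assoc)
  qed (simp add: integrable_nR_r)
  then show "dist (HCf f s) (HCf f t) \<le> (\<integral>\<theta>. nR \<theta> * r \<theta> \<partial>W) * dist s t" by (simp add: dist_norm)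
qed (auto intro!: Bochner_Integration.integral_nonneg_AE AE_I2 mult_nonneg_nonneg nR_nonneg r_nonneg)

lemma mk_norm_transported_le:
  assumes mu: "\<mu> \<in> cabv0"
  shows "mk_norm ip (transported \<mu>) \<le> (\<integral>\<theta>. nR \<theta> * r \<theta> \<partial>W) * mk_norm ip \<mu>"
  unfolding mk_norm_eq[of "transported \<mu>"]
proof (rule cSUP_least)
  have "1-lipschitz_on UNIV (\<lambda>_ :: 't. 0 :: 'x)" by (simp add: lipschitz_on_def)
  then show "{f :: 't \<Rightarrow> 'x. 1-lipschitz_on UNIV f} \<noteq> {}" by blast
  fix f :: "'t \<Rightarrow> 'x" assume "f \<in> {f. 1-lipschitz_on UNIV f}"
  then have f: "1-lipschitz_on UNIV f" by simp
  have "\<mu> \<in> cabv" using mu by (simp add: cabv0_def)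
  then have "sint ip f (transported \<mu>) = sint ip (HCf f) \<mu>"
    by (rule sint_transported[OF _ lipschitz_on_continuous_on[OF f]])
  then show "cmod (sint ip f (transported \<mu>)) \<le> (\<integral>\<theta>. nR \<theta> * r \<theta> \<partial>W) * mk_norm ip \<mu>"
    using cmod_sint_le_lipschitz[OF mu lipschitz_HCf[OF f]] by simp
qed

end

theorem theorem4p7:
  fixes K :: "complex set"
    and sc :: "complex \<Rightarrow> 'x::banach \<Rightarrow> 'x"
    and ip :: "'x \<Rightarrow> 'x \<Rightarrow> complex"
    and W :: "'th measure"
    and \<omega> :: "'t::metric_space \<Rightarrow> 'th \<Rightarrow> 't"
    and R :: "'x \<Rightarrow> 'th \<Rightarrow> 'x"
  assumes hilbert: "hilbert_space_over K sc ip"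
    and X_non_null: "\<exists>x::'x. x \<noteq> 0"
    and T_compact: "compact (UNIV :: 't set)"
    and T_two_elements: "\<exists>s t::'t. s \<noteq> t"
    and \<omega>_measurable: "(\<lambda>(t, \<theta>). \<omega> t \<theta>) \<in> measurable (borel \<Otimes>\<^sub>M W) borel"
    and R_measurable: "(\<lambda>(x, \<theta>). R x \<theta>) \<in> measurable (borel \<Otimes>\<^sub>M W) borel"
    and R_linear: "\<And>\<theta>. \<theta> \<in> space W \<Longrightarrow> cont_linear_over K sc (\<lambda>x. R x \<theta>)"
    and \<omega>_lipschitz: "\<And>\<theta>. \<theta> \<in> space W \<Longrightarrow> \<exists>C. C-lipschitz_on UNIV (\<lambda>t. \<omega> t \<theta>)"
    and norm_R_measurable: "(\<lambda>\<theta>. onorm (\<lambda>x. R x \<theta>)) \<in> borel_measurable W"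
    and norm_R_integrable:
      "integrable W (\<lambda>\<theta>. onorm (\<lambda>x. R x \<theta>) * (1 + lip_const (\<lambda>t. \<omega> t \<theta>)))"
    \<comment> \<open>The Bochner integrals defining \<^const>\<open>HC\<close> exist; automatic if \<open>X\<close> is separable.\<close>
    and HC_integrable:
      "\<And>(f :: 't \<Rightarrow>\<^sub>C 'x) t. bochner_integrable W (\<lambda>\<theta>. R (apply_bcontfun f (\<omega> t \<theta>)) \<theta>)"
  defines "H \<equiv> Hop ip W R \<omega>"
  shows "H ` cabv0 \<subseteq> cabv0 \<and>
    (\<forall>\<mu>\<in>cabv0. \<forall>\<nu>\<in>cabv0. H (\<lambda>A. \<mu> A + \<nu> A) = (\<lambda>A. H \<mu> A + H \<nu> A)) \<and>
    (\<forall>c\<in>K. \<forall>\<mu>\<in>cabv0. H (\<lambda>A. sc c (\<mu> A)) = (\<lambda>A. sc c (H \<mu> A))) \<and>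
    (\<forall>\<mu>\<in>cabv0. \<forall>\<epsilon>>0. \<exists>\<delta>>0. \<forall>\<nu>\<in>cabv0.
       mk_norm ip (\<lambda>A. \<nu> A - \<mu> A) < \<delta> \<longrightarrow> mk_norm ip (\<lambda>A. H \<nu> A - H \<mu> A) < \<epsilon>) \<and>
    mk_op_norm ip H \<le>
      ereal (\<integral>\<theta>. onorm (\<lambda>x. R x \<theta>) * lip_const (\<lambda>t. \<omega> t \<theta>) \<partial>W)"
proof -
  interpret random_operators K sc ip W \<omega> R
    using assms by (intro random_operators.intro random_operators_axioms.intro)
  define c where "c = (\<integral>\<theta>. nR \<theta> * r \<theta> \<partial>W)"
  have c: "0 \<le> c" unfolding c_def
    by (auto intro!: Bochner_Integration.integral_nonneg_AE AE_I2 mult_nonneg_nonneg nR_nonneg r_nonneg)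
  have cabv: "\<mu> \<in> cabv" if "\<mu> \<in> cabv0" for \<mu> :: "'t set \<Rightarrow> 'x" using that by (simp add: cabv0_def)
  have H: "H \<mu> = transported \<mu>" if "\<mu> \<in> cabv" for \<mu>
    unfolding H_def by (rule Hop_eq_transported[OF that])
  have le: "mk_norm ip (H \<mu>) \<le> c * mk_norm ip \<mu>" if "\<mu> \<in> cabv0" for \<mu>
    using mk_norm_transported_le[OF that] by (simp add: H cabv that c_def)
  have "H ` cabv0 \<subseteq> cabv0" using transported_cabv0 H cabv by auto
  moreover have "\<forall>\<mu>\<in>cabv0. \<forall>\<nu>\<in>cabv0. H (\<lambda>A. \<mu> A + \<nu> A) = (\<lambda>A. H \<mu> A + H \<nu> A)"
    by (simp add: H cabv cabv_add transported_add)
  moreover have "\<forall>c\<in>K. \<forall>\<mu>\<in>cabv0. H (\<lambda>A. sc c (\<mu> A)) = (\<lambda>A. sc c (H \<mu> A))"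
    by (simp add: H cabv cabv_sc transported_sc)
  moreover have "\<exists>\<delta>>0. \<forall>\<nu>\<in>cabv0. mk_norm ip (\<lambda>A. \<nu> A - \<mu> A) < \<delta> \<longrightarrow>
      mk_norm ip (\<lambda>A. H \<nu> A - H \<mu> A) < \<epsilon>" if mu: "\<mu> \<in> cabv0" and e: "0 < \<epsilon>" for \<mu> \<epsilon>
    \<comment> \<open>\<open>c\<close> itself may vanish, whence \<open>c + 1\<close>\<close>
  proof (intro exI[of _ "\<epsilon> / (c + 1)"] conjI ballI impI)
    show "0 < \<epsilon> / (c + 1)" using c e by simp
    fix \<nu> :: "'t set \<Rightarrow> 'x"
    assume nu: "\<nu> \<in> cabv0" and small: "mk_norm ip (\<lambda>A. \<nu> A - \<mu> A) < \<epsilon> / (c + 1)"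
    let ?d = "\<lambda>A. \<nu> A - \<mu> A"
    have d: "?d \<in> cabv0" using mu nu by (simp add: cabv0_def cabv_diff)
    have "mk_norm ip (\<lambda>A. H \<nu> A - H \<mu> A) = mk_norm ip (H ?d)"
      by (simp add: H cabv mu nu cabv_diff transported_diff)
    also have "\<dots> \<le> c * mk_norm ip ?d" by (rule le[OF d])
    also have "\<dots> \<le> (c + 1) * mk_norm ip ?d" using mk_norm_nonneg[OF d] by (simp add: algebra_simps)
    also have "\<dots> < \<epsilon>" using small c by (simp add: field_simps)
    finally show "mk_norm ip (\<lambda>A. H \<nu> A - H \<mu> A) < \<epsilon>" .
  qed
  moreover have "mk_op_norm ip H \<le> ereal c"
    unfolding mk_op_norm_def
  proof (rule SUP_least)
    fix \<mu> :: "'t set \<Rightarrow> 'x" assume "\<mu> \<in> {\<mu> \<in> cabv0. mk_norm ip \<mu> \<le> 1}"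
    then have "\<mu> \<in> cabv0" "mk_norm ip \<mu> \<le> 1" by auto
    then have "mk_norm ip (H \<mu>) \<le> c" using le[of \<mu>] mult_left_mono[of "mk_norm ip \<mu>" 1 c] c by simp
    then show "ereal (mk_norm ip (H \<mu>)) \<le> ereal c" by simp
  qed
  ultimately show ?thesis unfolding c_def by blast
qed

end
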